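(* Let $n=8$, so that $\dim V=16$, and let $E=C^2\oplus S_1$, a $k$-vector space of dimension $248$. Let $[\ ,\ ]:E\times E\to E$ be the unique antisymmetric bilinear map such that $[A,B']=AB'-B'A$ for $A,B'\in C^2$; $[A,\psi]=A\cdot\psi$ for $A\in C^2$, $\psi\in S_1$; and $[\phi,\psi]=\tilde L_2(\phi,\psi)$ for $\phi,\psi\in S_1$. Then $(E,[\ ,\ ])$ is a simple Lie algebra.
   Context: $k$ is a field of characteristic not $2$ or $3$; $V$ is a $2n$-dimensional $k$-vector space with a nondegenerate symmetric bilinear form $g$ of Witt index $n$ (hyperbolic). $C=C(V,g)$ is the Clifford algebra, $vw+wv=2g(v,w)1$ for $v,w\in V\subset C$, with its usual ${\mathbb Z}_2$-grading $C=C_+\oplus C_-$. $S$ is a fixed $2^n$-dimensional $k$-vector space (spinors) with an algebra isomorphism $C\cong End(S)$; $c\cdot\psi$ denotes the action of $c\in C$ on $\psi\in S$. $S=S_1\oplus S_2$ is the decomposition into half-spinor spaces: each $S_i$ has dimension $2^{n-1}$, $C_+$ preserves $S_1$ and $S_2$, and $C_-$ interchanges them. A spinor norm is a bilinear map $B:S\times S\to k$ with $B(v\cdot\phi,\psi)=B(\phi,v\cdot\psi)$ for all $v\in V$, $\phi,\psi\in S$; a nondegenerate spinor norm $B$ is fixed. An orthonormal basis of $V$ is a basis $x_1,\dots,x_{2n}$ with $g(x_i,x_j)=\pm\delta_{ij}$. $C^2\subset C$ is the span of the products $x_ix_j$, $i<j$ (independent of the choice of orthonormal basis); it is a Lie algebra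 under commutator, isomorphic to $\mathfrak{so}(V,g)$. The map $\tilde L_2:S\times S\to C^2$ is $\tilde L_2(\phi,\psi)=\frac12\sum_{i<j}g(x_i,x_i)g(x_j,x_j)B(\phi,x_jx_i\cdot\psi)\,x_ix_j$ for any orthonormal basis (independent of the choice); for $n\equiv0$ mod $4$ it is antisymmetric. *)

theory Defs
  imports
    "HOL-Analysis.Product_Vector"
    "HOL-Library.Poly_Mapping"
    "HOL-Library.FuncSet"
    "HOL-Computational_Algebra.Computational_Algebra"
begin

section \<open>Symmetric bilinear forms\<close>

definition bilinear_form ::
  "('k::field \<Rightarrow> 'v::ab_group_add \<Rightarrow> 'v) \<Rightarrow> ('v \<Rightarrow> 'v \<Rightarrow> 'k) \<Rightarrow> bool" where
  "bilinear_form s b \<longleftrightarrow>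
     (\<forall>v. Vector_Spaces.linear s (*) (\<lambda>w. b v w)) \<and>
     (\<forall>w. Vector_Spaces.linear s (*) (\<lambda>v. b v w))"

definition nondegenerate :: "('v::zero \<Rightarrow> 'v \<Rightarrow> 'k::zero) \<Rightarrow> bool" where
  "nondegenerate b \<longleftrightarrow>
     (\<forall>v. (\<forall>w. b v w = 0) \<longrightarrow> v = 0) \<and> (\<forall>w. (\<forall>v. b v w = 0) \<longrightarrow> w = 0)"

text \<open>The largest dimension of a totally isotropic subspace. The set is finite whenever the
  whole space is finite dimensional, so that \<^const>\<open>Max\<close> is meaningful.\<close>

definition witt_index ::
  "('k::field \<Rightarrow> 'v::ab_group_add \<Rightarrow> 'v) \<Rightarrow> ('v \<Rightarrow> 'v \<Rightarrow> 'k) \<Rightarrow> nat" where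
  "witt_index s g =
     Max {vector_space.dim s W | W. module.subspace s W \<and> (\<forall>v\<in>W. \<forall>w\<in>W. g v w = 0)}"

definition orthonormal_basis ::
  "('k::field \<Rightarrow> 'v::ab_group_add \<Rightarrow> 'v) \<Rightarrow> ('v \<Rightarrow> 'v \<Rightarrow> 'k) \<Rightarrow> nat \<Rightarrow> (nat \<Rightarrow> 'v) \<Rightarrow> bool" where
  "orthonormal_basis s g m x \<longleftrightarrow>
     inj_on x {1..m} \<and>
     \<not> module.dependent s (x ` {1..m}) \<and>
     module.span s (x ` {1..m}) = UNIV \<and>
     (\<forall>i\<in>{1..m}. g (x i) (x i) = 1 \<or> g (x i) (x i) = - 1) \<and>
     (\<forall>i\<in>{1..m}. \<forall>j\<in>{1..m}. i \<noteq> j \<longrightarrow> g (x i) (x j) = 0)"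

section \<open>The Clifford algebra\<close>

definition unital_algebra :: "('k::field \<Rightarrow> 'c::ring_1 \<Rightarrow> 'c) \<Rightarrow> bool" where
  "unital_algebra s \<longleftrightarrow>
     vector_space s \<and>
     (\<forall>a x y. s a (x * y) = s a x * y) \<and>
     (\<forall>a x y. s a (x * y) = x * s a y)"

text \<open>Formal linear combinations of words in \<open>V\<close> are the elements of the free algebra on the set
  \<open>V\<close>, whose product is concatenation of words. The set below is its two-sided ideal generated by
  the relations expressing that \<open>V\<close> embeds linearly (the quotient by these is the tensor
  algebra of \<open>V\<close>) and by the Clifford relations \<open>v w + w v = 2 g(v,w) 1\<close>. Since the words form
  a basis, multiplying the relations by words on both sides suffices to get a two-sided ideal.\<close>

inductive_set clifford_ideal ::
  "('k::field \<Rightarrow> 'v::ab_group_add \<Rightarrow> 'v) \<Rightarrow> ('v \<Rightarrow> 'v \<Rightarrow> 'k) \<Rightarrow> ('v list \<Rightarrow>\<^sub>0 'k) set"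
  for s g where
  zero: "0 \<in> clifford_ideal s g"
| add: "p \<in> clifford_ideal s g \<Longrightarrow> q \<in> clifford_ideal s g \<Longrightarrow> p + q \<in> clifford_ideal s g"
| scale: "p \<in> clifford_ideal s g \<Longrightarrow> Poly_Mapping.map ((*) a) p \<in> clifford_ideal s g"
| rel_add:
    "Poly_Mapping.single (us @ [v + w] @ ws) 1
       - Poly_Mapping.single (us @ [v] @ ws) 1
       - Poly_Mapping.single (us @ [w] @ ws) 1 \<in> clifford_ideal s g"
| rel_scale:
    "Poly_Mapping.single (us @ [s a v] @ ws) 1
       - Poly_Mapping.single (us @ [v] @ ws) a \<in> clifford_ideal s g"
| rel_clifford:
    "Poly_Mapping.single (us @ [v, w] @ ws) 1
       + Poly_Mapping.single (us @ [w, v] @ ws) 1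
       - Poly_Mapping.single (us @ ws) (2 * g v w) \<in> clifford_ideal s g"

definition word_eval ::
  "('k::field \<Rightarrow> 'c::ring_1 \<Rightarrow> 'c) \<Rightarrow> ('v \<Rightarrow> 'c) \<Rightarrow> ('v list \<Rightarrow>\<^sub>0 'k) \<Rightarrow> 'c" where
  "word_eval sC \<iota> p =
     (\<Sum>vs\<in>Poly_Mapping.keys p. sC (Poly_Mapping.lookup p vs) (prod_list (map \<iota> vs)))"

text \<open>The algebra \<open>C\<close> with \<open>\<iota> : V \<rightarrow> C\<close> is the quotient of the free algebra by
  \<^const>\<open>clifford_ideal\<close>: evaluation of words is onto, with this ideal as its kernel.\<close>

definition is_clifford_algebra ::
  "('k::field \<Rightarrow> 'v::ab_group_add \<Rightarrow> 'v) \<Rightarrow> ('v \<Rightarrow> 'v \<Rightarrow> 'k) \<Rightarrow>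
   ('k \<Rightarrow> 'c::ring_1 \<Rightarrow> 'c) \<Rightarrow> ('v \<Rightarrow> 'c) \<Rightarrow> bool" where
  "is_clifford_algebra sV g sC \<iota> \<longleftrightarrow>
     unital_algebra sC \<and>
     range (word_eval sC \<iota>) = UNIV \<and>
     {p. word_eval sC \<iota> p = 0} = clifford_ideal sV g"

definition clifford_even :: "('k::field \<Rightarrow> 'c::ring_1 \<Rightarrow> 'c) \<Rightarrow> ('v \<Rightarrow> 'c) \<Rightarrow> 'c set" where
  "clifford_even sC \<iota> = module.span sC {prod_list (map \<iota> vs) | vs. even (length vs)}"

definition clifford_odd :: "('k::field \<Rightarrow> 'c::ring_1 \<Rightarrow> 'c) \<Rightarrow> ('v \<Rightarrow> 'c) \<Rightarrow> 'c set" where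
  "clifford_odd sC \<iota> = module.span sC {prod_list (map \<iota> vs) | vs. odd (length vs)}"

definition clifford_two ::
  "('k::field \<Rightarrow> 'c::ring_1 \<Rightarrow> 'c) \<Rightarrow> ('v \<Rightarrow> 'c) \<Rightarrow> nat \<Rightarrow> (nat \<Rightarrow> 'v) \<Rightarrow> 'c set" where
  "clifford_two sC \<iota> m x = module.span sC {\<iota> (x i) * \<iota> (x j) | i j. 1 \<le> i \<and> i < j \<and> j \<le> m}"

section \<open>Spinors\<close>

definition algebra_iso_End ::
  "('k::field \<Rightarrow> 'c::ring_1 \<Rightarrow> 'c) \<Rightarrow> ('k \<Rightarrow> 's::ab_group_add \<Rightarrow> 's) \<Rightarrow> ('c \<Rightarrow> 's \<Rightarrow> 's) \<Rightarrow> bool" where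
  "algebra_iso_End sC sS \<rho> \<longleftrightarrow>
     bij_betw \<rho> UNIV {f. Vector_Spaces.linear sS sS f} \<and>
     (\<forall>c d \<psi>. \<rho> (c + d) \<psi> = \<rho> c \<psi> + \<rho> d \<psi>) \<and>
     (\<forall>a c \<psi>. \<rho> (sC a c) \<psi> = sS a (\<rho> c \<psi>)) \<and>
     (\<forall>c d. \<rho> (c * d) = \<rho> c \<circ> \<rho> d) \<and>
     \<rho> 1 = id"

definition half_spinor_decomposition ::
  "('k::field \<Rightarrow> 'c::ring_1 \<Rightarrow> 'c) \<Rightarrow> ('v \<Rightarrow> 'c) \<Rightarrow>
   ('k \<Rightarrow> 's::ab_group_add \<Rightarrow> 's) \<Rightarrow> ('c \<Rightarrow> 's \<Rightarrow> 's) \<Rightarrow> nat \<Rightarrow> 's set \<Rightarrow> 's set \<Rightarrow> bool" where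
  "half_spinor_decomposition sC \<iota> sS \<rho> n S1 S2 \<longleftrightarrow>
     module.subspace sS S1 \<and> module.subspace sS S2 \<and>
     S1 \<inter> S2 = {0} \<and> {\<phi> + \<psi> | \<phi> \<psi>. \<phi> \<in> S1 \<and> \<psi> \<in> S2} = UNIV \<and>
     vector_space.dim sS S1 = 2 ^ (n - 1) \<and> vector_space.dim sS S2 = 2 ^ (n - 1) \<and>
     (\<forall>c\<in>clifford_even sC \<iota>. \<rho> c ` S1 \<subseteq> S1 \<and> \<rho> c ` S2 \<subseteq> S2) \<and>
     (\<forall>c\<in>clifford_odd sC \<iota>. \<rho> c ` S1 \<subseteq> S2 \<and> \<rho> c ` S2 \<subseteq> S1)"

definition spinor_norm ::
  "('v \<Rightarrow> 'c) \<Rightarrow> ('k::field \<Rightarrow> 's::ab_group_add \<Rightarrow> 's) \<Rightarrow> ('c \<Rightarrow> 's \<Rightarrow> 's) \<Rightarrow>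
   ('s \<Rightarrow> 's \<Rightarrow> 'k) \<Rightarrow> bool" where
  "spinor_norm \<iota> sS \<rho> B \<longleftrightarrow>
     bilinear_form sS B \<and> (\<forall>v \<phi> \<psi>. B (\<rho> (\<iota> v) \<phi>) \<psi> = B \<phi> (\<rho> (\<iota> v) \<psi>))"

definition L2_tilde ::
  "('v \<Rightarrow> 'v \<Rightarrow> 'k::field) \<Rightarrow> ('k \<Rightarrow> 'c::ring_1 \<Rightarrow> 'c) \<Rightarrow> ('v \<Rightarrow> 'c) \<Rightarrow> ('c \<Rightarrow> 's \<Rightarrow> 's) \<Rightarrow>
   ('s \<Rightarrow> 's \<Rightarrow> 'k) \<Rightarrow> nat \<Rightarrow> (nat \<Rightarrow> 'v) \<Rightarrow> 's \<Rightarrow> 's \<Rightarrow> 'c" where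
  "L2_tilde g sC \<iota> \<rho> B m x \<phi> \<psi> =
     sC (1 / 2)
       (\<Sum>j=1..m. \<Sum>i=1..<j.
          sC (g (x i) (x i) * g (x j) (x j) * B \<phi> (\<rho> (\<iota> (x j) * \<iota> (x i)) \<psi>))
            (\<iota> (x i) * \<iota> (x j)))"

section \<open>Lie algebras on a subspace\<close>

text \<open>The bracket is a function on \<open>E \<times> E\<close>; its values outside are irrelevant.\<close>

definition bilinear_on ::
  "('k::field \<Rightarrow> 'e::ab_group_add \<Rightarrow> 'e) \<Rightarrow> 'e set \<Rightarrow> ('e \<times> 'e \<Rightarrow> 'e) \<Rightarrow> bool" where
  "bilinear_on s E br \<longleftrightarrow>
     (\<forall>x\<in>E. \<forall>y\<in>E. \<forall>z\<in>E. br (x + y, z) = br (x, z) + br (y, z)) \<and>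
     (\<forall>x\<in>E. \<forall>y\<in>E. \<forall>z\<in>E. br (x, y + z) = br (x, y) + br (x, z)) \<and>
     (\<forall>a. \<forall>x\<in>E. \<forall>y\<in>E. br (s a x, y) = s a (br (x, y))) \<and>
     (\<forall>a. \<forall>x\<in>E. \<forall>y\<in>E. br (x, s a y) = s a (br (x, y)))"

definition lie_algebra ::
  "('k::field \<Rightarrow> 'e::ab_group_add \<Rightarrow> 'e) \<Rightarrow> 'e set \<Rightarrow> ('e \<times> 'e \<Rightarrow> 'e) \<Rightarrow> bool" where
  "lie_algebra s E br \<longleftrightarrow>
     vector_space s \<and> module.subspace s E \<and>
     br \<in> E \<times> E \<rightarrow> E \<and> bilinear_on s E br \<and>
     (\<forall>x\<in>E. br (x, x) = 0) \<and>
     (\<forall>x\<in>E. \<forall>y\<in>E. \<forall>z\<in>E.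
        br (x, br (y, z)) + br (y, br (z, x)) + br (z, br (x, y)) = 0)"

definition lie_ideal ::
  "('k::field \<Rightarrow> 'e::ab_group_add \<Rightarrow> 'e) \<Rightarrow> 'e set \<Rightarrow> ('e \<times> 'e \<Rightarrow> 'e) \<Rightarrow> 'e set \<Rightarrow> bool" where
  "lie_ideal s E br I \<longleftrightarrow>
     module.subspace s I \<and> I \<subseteq> E \<and> (\<forall>x\<in>E. \<forall>y\<in>I. br (x, y) \<in> I)"

definition simple_lie_algebra ::
  "('k::field \<Rightarrow> 'e::ab_group_add \<Rightarrow> 'e) \<Rightarrow> 'e set \<Rightarrow> ('e \<times> 'e \<Rightarrow> 'e) \<Rightarrow> bool" where
  "simple_lie_algebra s E br \<longleftrightarrow>
     lie_algebra s E br \<and>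
     (\<exists>x\<in>E. \<exists>y\<in>E. br (x, y) \<noteq> 0) \<and>
     (\<forall>I. lie_ideal s E br I \<longrightarrow> I = {0} \<or> I = E)"

section \<open>The bracket on bivectors plus half-spinors\<close>

text \<open>The direct sum of \<open>C2\<close> and \<open>S1\<close> is \<open>C2 \<times> S1\<close>, with \<open>A\<close> and \<open>\<psi>\<close> identified with \<open>(A, 0)\<close>
  and \<open>(0, \<psi>)\<close>. Extensionality (the function space \<open>\<rightarrow>\<^sub>E\<close>) only pins down the values outside
  \<open>E \<times> E\<close>, so that uniqueness of the bracket becomes uniqueness of a HOL function.\<close>

definition bivector_spinor_bracket ::
  "('k::field \<Rightarrow> 'c::ring_1 \<times> 's::ab_group_add \<Rightarrow> 'c \<times> 's) \<Rightarrow> ('c \<Rightarrow> 's \<Rightarrow> 's) \<Rightarrow>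
   ('s \<Rightarrow> 's \<Rightarrow> 'c) \<Rightarrow> 'c set \<Rightarrow> 's set \<Rightarrow> (('c \<times> 's) \<times> ('c \<times> 's) \<Rightarrow> 'c \<times> 's) \<Rightarrow> bool" where
  "bivector_spinor_bracket s \<rho> L C2 S1 br \<longleftrightarrow>
     br \<in> (C2 \<times> S1) \<times> (C2 \<times> S1) \<rightarrow>\<^sub>E C2 \<times> S1 \<and>
     bilinear_on s (C2 \<times> S1) br \<and>
     (\<forall>x\<in>C2 \<times> S1. \<forall>y\<in>C2 \<times> S1. br (x, y) = - br (y, x)) \<and>
     (\<forall>A\<in>C2. \<forall>A'\<in>C2. br ((A, 0), (A', 0)) = (A * A' - A' * A, 0)) \<and>
     (\<forall>A\<in>C2. \<forall>\<psi>\<in>S1. br ((A, 0), (0, \<psi>)) = (0, \<rho> A \<psi>)) \<and>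
     (\<forall>\<phi>\<in>S1. \<forall>\<psi>\<in>S1. br ((0, \<phi>), (0, \<psi>)) = (L \<phi> \<psi>, 0))"

end

theory Submission
  imports Defs
begin

text \<open>
  Write \<open>e\<^sub>K\<close> for the product, in increasing order, of the generators \<open>x\<^sub>i\<close> with \<open>i \<in> K\<close>. These
  \<open>2\<^sup>1\<^sup>6\<close> monomials multiply like group elements up to sign and form a basis of \<open>C\<close>
  (\<open>monomial_mult\<close>, \<open>monomials_independent\<close>), and the coefficient at the empty set is a trace on
  \<open>C = End S\<close>, normalised to \<open>1\<close> at the identity. Hence a rank-one operator \<open>f(-) \<phi>\<close> has trace
  \<open>f \<phi> / 256\<close>, and reading off its coefficients gives the Fierz identity (\<open>fierz\<close>)
  \<open>B(\<psi>,\<chi>) \<phi> = 1/256 \<Sum>\<^sub>K e\<^sub>K\<^sup>2 B(\<psi>, e\<^sub>K \<phi>) e\<^sub>K \<chi>\<close>, where \<open>e\<^sub>K\<^sup>2 = \<plusminus>1\<close>.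

  All properties of the bracket follow from this identity. Contracting it shows that \<open>B\<close> is
  symmetric, because the reversal signs \<open>(-1)\<^bsup>k(k-1)/2\<^esup>\<close> of all monomials add up to \<open>256\<close>; so
  \<open>L\<close> is antisymmetric. On bivectors, \<open>tr (L(\<phi>,\<psi>) A) = B(\<phi>, A \<psi>) / 2\<close>; as bivectors are
  skew for \<open>B\<close>, this makes \<open>L\<close> equivariant, which is the Jacobi identity with one bivector and two
  spinors. The essential case is three half-spinors (\<open>spinor_jacobi\<close>). There twice the sum of
  two cyclic terms is the result of applying the operator \<open>\<Sum>\<^sub>P e\<^sub>P D e\<^sub>P\<^sup>-\<^sup>1\<close>, summed over two-element sets
  \<open>P\<close>, to the third spinor, with \<open>D = \<phi> \<otimes> B(\<psi>,-) - \<psi> \<otimes> B(\<phi>,-)\<close>. Only monomials of degrees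
  \<open>2, 6, 10, 14\<close> occur in \<open>D\<close>, and the sandwich multiplies them by \<open>120 - 2k(16-k)\<close>, that is, by
  \<open>64, 0, 0, 64\<close>. The vanishing in degrees \<open>6\<close> and \<open>10\<close> is where dimension sixteen is essential. On
  half-spinors the product of all generators is a scalar, so degree \<open>14\<close> repeats degree \<open>2\<close>, and
  what remains is the third cyclic term.

  For simplicity, \<open>(ad e\<^sub>P)\<^sup>2\<close> has eigenvalues \<open>0\<close> and \<open>4 e\<^sub>P\<^sup>2\<close> on bivectors but \<open>e\<^sub>P\<^sup>2\<close> on
  spinors. As \<open>3\<close> is invertible, an ideal therefore contains the components of its elements. If it
  contains a nonzero spinor, it contains a nonzero bivector by nondegeneracy of \<open>B\<close>; the
  operators \<open>(ad e\<^sub>P)\<^sup>2\<close> then cut this bivector down to a single monomial, whose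
  brackets reach every other one (\<open>bivector_ideal_full\<close>). Since \<open>e\<^sub>P\<close> acts invertibly on spinors,
  the ideal is everything.
\<close>

section \<open>Reversal signs\<close>

text \<open>The sign of the permutation that reverses a word of length \<open>k\<close> in anticommuting letters.\<close>

definition swap_sign :: "nat \<Rightarrow> 'k::ring_1" where
  "swap_sign k = (- 1) ^ (k choose 2)"

lemma swap_sign_Suc: "swap_sign (Suc k) = (- 1) ^ k * swap_sign k"
  by (simp add: swap_sign_def numeral_2_eq_2 power_add)

lemma swap_sign_square: "swap_sign k * swap_sign k = 1"
  by (simp add: swap_sign_def flip: power_add)

lemma swap_sign_mod4:
  "swap_sign k = (if k mod 4 \<in> {0, 1} then 1 else - 1 :: 'a::ring_1)"
proof (induction k)
  case 0
  then show ?case by (simp add: swap_sign_def numeral_2_eq_2)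
next
  case (Suc k)
  have "k mod 4 < 4" by simp
  then consider "k mod 4 = 0" | "k mod 4 = 1" | "k mod 4 = 2" | "k mod 4 = 3" by linarith
  then show ?case
  proof cases
    case 1
    then have "Suc k mod 4 = 1" "even k" by presburger+
    then show ?thesis using Suc 1 by (simp add: swap_sign_Suc)
  next
    case 2
    then have "Suc k mod 4 = 2" "odd k" by presburger+
    then show ?thesis using Suc 2 by (simp add: swap_sign_Suc)
  next
    case 3
    then have "Suc k mod 4 = 3" "even k" by presburger+
    then show ?thesis using Suc 3 by (simp add: swap_sign_Suc)
  next
    case 4
    then have "Suc k mod 4 = 0" "odd k" by presburger+
    then show ?thesis using Suc 4 by (simp add: swap_sign_Suc)
  qed
qed

section \<open>Products of orthonormal generators\<close>

text \<open>An abstraction of the Clifford algebra with a chosen orthonormal basis: \<open>y i\<close> stands for the image of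
  the \<open>i\<close>-th basis vector and \<open>\<eta> i\<close> for its norm. Generation is stated through left multiplication, the
  form in which it is used for induction. That \<open>card I\<close> is even makes the product of all generators
  anticommute with each of them; in odd dimension this product is central and the monomials may become
  linearly dependent.\<close>

locale clifford_frame = vector_space sC
  for sC :: "'k::field \<Rightarrow> 'c::ring_1 \<Rightarrow> 'c" +
  fixes y :: "nat \<Rightarrow> 'c" and \<eta> :: "nat \<Rightarrow> 'k" and I :: "nat set"
  assumes scale_mult_left: "sC a c * d = sC a (c * d)"
    and scale_mult_right: "c * sC a d = sC a (c * d)"
    and two_nonzero: "(2::'k) \<noteq> 0"
    and one_nonzero: "(1::'c) \<noteq> 0"
    and finite_I: "finite I"
    and even_I: "even (card I)"
    and gen_square: "i \<in> I \<Longrightarrow> y i * y i = sC (\<eta> i) 1"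
    and eta_square: "i \<in> I \<Longrightarrow> \<eta> i * \<eta> i = 1"
    and gen_anticommute: "i \<in> I \<Longrightarrow> j \<in> I \<Longrightarrow> i \<noteq> j \<Longrightarrow> y i * y j = - (y j * y i)"
    and generate: "subspace W \<Longrightarrow> 1 \<in> W \<Longrightarrow> (\<And>i w. i \<in> I \<Longrightarrow> w \<in> W \<Longrightarrow> y i * w \<in> W) \<Longrightarrow> W = UNIV"
begin

lemmas scale_mult = scale_mult_left scale_mult_right

definition monomial :: "nat set \<Rightarrow> 'c" where
  "monomial K = prod_list (map y (sorted_list_of_set K))"

lemma one_neq_minus_one: "(1::'k) \<noteq> - 1" "- 1 \<noteq> (1::'k)"
  using two_nonzero by (simp_all add: eq_neg_iff_add_eq_0 neg_eq_iff_add_eq_0)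

lemma finite_Pow_I [simp]: "finite (Pow I)" "finite I"
  by (simp_all add: finite_I)

lemma monomial_empty [simp]: "monomial {} = 1"
  by (simp add: monomial_def)

lemma monomial_insert_min:
  assumes "finite K" "\<forall>k\<in>K. b < k"
  shows "monomial (insert b K) = y b * monomial K"
proof -
  have "b \<notin> K" using assms(2) by blast
  then have "sorted_list_of_set (insert b K) = insort b (sorted_list_of_set K)"
    using assms(1) by simp
  also have "\<dots> = b # sorted_list_of_set K"
    using assms by (intro insort_is_Cons) auto
  finally show ?thesis by (simp add: monomial_def)
qed

lemma monomial_singleton [simp]: "monomial {i} = y i"
  using monomial_insert_min[of "{}" i] by simp

lemma monomial_pair: "i < j \<Longrightarrow> monomial {i, j} = y i * y j"
  using monomial_insert_min[of "{j}" i] by simp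

lemma finite_index: "K \<subseteq> I \<Longrightarrow> finite K"
  using finite_I by (rule rev_finite_subset)

lemma gen_left_anticommute:
  "i \<in> I \<Longrightarrow> j \<in> I \<Longrightarrow> i \<noteq> j \<Longrightarrow> y i * (y j * w) = - (y j * (y i * w))"
  using gen_anticommute[of i j] by (simp add: mult.assoc[symmetric])

lemma gen_left_square: "i \<in> I \<Longrightarrow> y i * (y i * w) = sC (\<eta> i) w"
  by (simp add: mult.assoc[symmetric] gen_square scale_mult)

text \<open>Adding indices below all present ones keeps monomials sorted, so that each step is a left multiplication by a generator.\<close>

lemma index_set_induct [consumes 1, case_names empty insert]:
  assumes "K \<subseteq> I" "P {}"
    and "\<And>b K. b \<in> I \<Longrightarrow> K \<subseteq> I \<Longrightarrow> finite K \<Longrightarrow> \<forall>k\<in>K. b < k \<Longrightarrow> b \<notin> K \<Longrightarrow> P K \<Longrightarrow> P (insert b K)"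
  shows "P K"
proof -
  from assms(1) have "finite K" by (rule finite_index)
  then show ?thesis using assms(1)
  proof (induction K rule: finite_linorder_min_induct)
    case (insert b A)
    then show ?case using assms(3)[of b A] by auto
  qed (rule assms(2))
qed

lemma gen_monomial_commute_notin:
  assumes "K \<subseteq> I" "j \<in> I"
  shows "j \<notin> K \<Longrightarrow> y j * monomial K = sC ((- 1) ^ card K) (monomial K * y j)"
  using assms(1)
proof (induction rule: index_set_induct)
  case (insert b K)
  have "y j * monomial (insert b K) = - (y b * (y j * monomial K))"
    using gen_left_anticommute[of j b] insert assms(2) by (auto simp: monomial_insert_min)
  then show ?case using insert
    by (simp add: monomial_insert_min scale_mult mult.assoc)
qed simp

text \<open>Only that the scalar is a sign matters below, hence \<open>s * s = 1\<close> in place of a formula: sorting the new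
  generator into place produces signs, and meeting its own copy produces \<open>\<eta> j = \<plusminus>1\<close>.\<close>

lemma gen_monomial:
  assumes "K \<subseteq> I" "j \<in> I"
  shows "\<exists>s. s * s = 1 \<and> y j * monomial K = sC s (monomial (sym_diff K {j}))"
  using assms(1)
proof (induction rule: index_set_induct)
  case empty
  then show ?case by (auto intro: exI[of _ 1])
next
  case (insert b K)
  consider "j < b" | "j = b" | "b < j" by linarith
  then show ?case
  proof cases
    case 1
    with insert have "\<forall>k\<in>insert b K. j < k" "finite (insert b K)" "j \<notin> insert b K" by auto
    moreover from this have "sym_diff (insert b K) {j} = insert j (insert b K)" by blast
    ultimately show ?thesis using monomial_insert_min[of "insert b K" j] by (auto intro: exI[of _ 1])
  next
    case 2
    with insert have "sym_diff (insert b K) {j} = K" by auto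
    moreover have "y j * monomial (insert b K) = sC (\<eta> j) (monomial K)"
      using insert 2 by (simp add: monomial_insert_min gen_left_square)
    ultimately show ?thesis using eta_square[OF assms(2)] by auto
  next
    case 3
    then obtain s where s: "s * s = 1" "y j * monomial K = sC s (monomial (sym_diff K {j}))"
      using insert by auto
    have "sym_diff (insert b K) {j} = insert b (sym_diff K {j})" using 3 by auto
    moreover have "monomial (insert b (sym_diff K {j})) = y b * monomial (sym_diff K {j})"
      using insert 3 by (intro monomial_insert_min) auto
    moreover have "y j * monomial (insert b K) = - (y b * (y j * monomial K))"
      using gen_left_anticommute[of j b] insert assms(2) 3 by (auto simp: monomial_insert_min)
    ultimately show ?thesis using s by (intro exI[of _ "- s"]) (simp add: scale_mult)
  qed
qed

lemma monomial_mult: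
  assumes "K \<subseteq> I" "L \<subseteq> I"
  shows "\<exists>s. s * s = 1 \<and> monomial K * monomial L = sC s (monomial (sym_diff K L))"
  using assms(1)
proof (induction rule: index_set_induct)
  case empty
  then show ?case by (auto intro: exI[of _ 1])
next
  case (insert b K)
  then obtain s where s: "s * s = 1" "monomial K * monomial L = sC s (monomial (sym_diff K L))"
    by auto
  have "sym_diff K L \<subseteq> I" using insert assms(2) by blast
  then obtain r where r: "r * r = 1"
      "y b * monomial (sym_diff K L) = sC r (monomial (sym_diff (sym_diff K L) {b}))"
    using gen_monomial insert.hyps(1) by blast
  have "sym_diff (sym_diff K L) {b} = sym_diff (insert b K) L" using insert by auto
  then have "monomial (insert b K) * monomial L = sC (s * r) (monomial (sym_diff (insert b K) L))"
    using insert s r by (simp add: monomial_insert_min mult.assoc scale_mult)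
  moreover have "(s * r) * (s * r) = 1" using s(1) r(1) by (simp add: algebra_simps)
  ultimately show ?case by blast
qed

lemma monomial_commute:
  assumes "K \<subseteq> I" "L \<subseteq> I"
  shows "monomial K * monomial L =
    sC ((- 1) ^ (card K * card L + card (K \<inter> L))) (monomial L * monomial K)"
  using assms(1)
proof (induction rule: index_set_induct)
  case (insert b K)
  have fin: "finite L" using assms(2) by (rule finite_index)
  have 1: "y b * monomial L = sC ((- 1) ^ (card L + card ({b} \<inter> L))) (monomial L * y b)"
  proof (cases "b \<in> L")
    case False
    then show ?thesis using gen_monomial_commute_notin[OF assms(2) insert.hyps(1)] by simp
  next
    case True
    let ?M = "L - {b}"
    have M: "?M \<subseteq> I" "b \<notin> ?M" using assms(2) by auto
    \<comment> \<open>\<open>monomial L\<close> is a scalar multiple of \<open>y b * monomial ?M\<close>, which reduces to the case above\<close>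
    obtain s where s: "s * s = 1" "y b * monomial ?M = sC s (monomial (sym_diff ?M {b}))"
      using gen_monomial[OF M(1) insert.hyps(1)] by auto
    have "sym_diff ?M {b} = L" using True by blast
    then have L: "monomial L = sC s (y b * monomial ?M)" by (simp only: s scale_scale scale_one)
    define p where "p = (- 1 :: 'k) ^ card ?M"
    have p: "p * p = 1" by (simp add: p_def flip: power_mult_distrib)
    have yM: "y b * monomial ?M = sC p (monomial ?M * y b)"
      using gen_monomial_commute_notin[OF M(1) insert.hyps(1) M(2)] by (simp add: p_def)
    then have My: "monomial ?M * y b = sC p (y b * monomial ?M)" by (simp add: p)
    have cL: "(- 1 :: 'k) ^ (card L + card ({b} \<inter> L)) = p"
      unfolding p_def by (subst card.remove[OF fin True]) (use True in simp)
    have "y b * monomial L = sC (s * \<eta> b) (monomial ?M)"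
      by (simp add: L scale_mult gen_left_square insert.hyps(1))
    also have "\<dots> = sC (p * p) (sC (s * \<eta> b) (monomial ?M))"
      by (simp add: p)
    also have "\<dots> = sC p (monomial L * y b)"
      by (simp add: L scale_mult mult.assoc My gen_left_square insert.hyps(1) mult_ac)
    finally show ?thesis unfolding cL .
  qed
  have "monomial (insert b K) * monomial L = y b * (monomial K * monomial L)"
    using insert by (simp add: monomial_insert_min mult.assoc)
  also have "\<dots> = sC ((- 1) ^ (card K * card L + card (K \<inter> L))) (y b * monomial L * monomial K)"
    by (simp only: insert.IH scale_mult mult.assoc)
  also have "\<dots> = sC ((- 1) ^ (card K * card L + card (K \<inter> L) + (card L + card ({b} \<inter> L))))
      (monomial L * (y b * monomial K))"
    by (simp add: 1 scale_mult mult.assoc power_add)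
  also have "card K * card L + card (K \<inter> L) + (card L + card ({b} \<inter> L)) =
      card (insert b K) * card L + card (insert b K \<inter> L)"
    using insert by (auto simp: Int_insert_left)
  finally show ?case using insert by (simp add: monomial_insert_min)
qed simp

text \<open>The scalar \<open>\<plusminus>1\<close> by which a monomial squares; equivalently the factor turning it into its inverse.\<close>

definition mono_sq :: "nat set \<Rightarrow> 'k" where
  "mono_sq K = swap_sign (card K) * prod \<eta> K"

lemma monomial_square:
  assumes "K \<subseteq> I"
  shows "monomial K * monomial K = sC (mono_sq K) 1"
  using assms
proof (induction rule: index_set_induct)
  case (insert b K)
  have "monomial (insert b K) * monomial (insert b K) = y b * ((monomial K * y b) * monomial K)"
    using insert by (simp add: monomial_insert_min mult.assoc)
  also have "monomial K * y b = sC ((- 1) ^ card K) (y b * monomial K)"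
    using gen_monomial_commute_notin[of K b] insert by (simp flip: power_mult_distrib)
  finally show ?case using insert
    by (simp add: scale_mult mult.assoc mono_sq_def swap_sign_Suc gen_left_square gen_square mult_ac)
qed (simp add: mono_sq_def swap_sign_def numeral_2_eq_2)

lemma mono_sq_square:
  assumes "K \<subseteq> I"
  shows "mono_sq K * mono_sq K = 1"
proof -
  have "prod \<eta> K * prod \<eta> K = (\<Prod>k\<in>K. \<eta> k * \<eta> k)" by (simp add: prod.distrib)
  also have "\<dots> = 1" using assms eta_square by (intro prod.neutral) auto
  finally have "prod \<eta> K * prod \<eta> K = 1" .
  moreover have "mono_sq K * mono_sq K =
      (swap_sign (card K) * swap_sign (card K)) * (prod \<eta> K * prod \<eta> K)"
    by (simp add: mono_sq_def algebra_simps)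
  ultimately show ?thesis by (simp add: swap_sign_square)
qed

lemma monomial_nonzero: "K \<subseteq> I \<Longrightarrow> monomial K \<noteq> 0"
  using monomial_square[of K] mono_sq_square[of K] one_nonzero by auto

text \<open>A nontrivial relation of minimal support cannot exist. Given two sets \<open>K \<noteq> L\<close> in its support, some
  generator \<open>y j\<close> commutes with one of the two monomials and anticommutes with the other: if the
  cardinalities have equal parity take \<open>j\<close> in the symmetric difference, otherwise outside it, which
  is possible since an odd set is not all of \<open>I\<close>. Subtracting a multiple of the relation
  from its conjugate by \<open>y j\<close> removes \<open>L\<close> and keeps \<open>K\<close>.\<close>

lemma monomials_independent_support:
  assumes "F \<subseteq> Pow I" "\<forall>K\<in>F. a K \<noteq> 0" "(\<Sum>K\<in>F. sC (a K) (monomial K)) = 0"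
  shows "F = {}"
  using assms
proof (induction "card F" arbitrary: F a rule: less_induct)
  case less
  have finF: "finite F" using less.prems(1) by (rule finite_subset) (simp add: finite_I)
  show ?case
  proof (rule ccontr)
    assume "F \<noteq> {}"
    then obtain L where L: "L \<in> F" by blast
    have LN: "L \<subseteq> I" "finite L" using L less.prems(1) finite_index by auto
    show False
    proof (cases "F = {L}")
      case True
      then show False using less.prems monomial_nonzero[OF LN(1)] by simp
    next
      case False
      then obtain K where K: "K \<in> F" "K \<noteq> L" using L by blast
      have KN: "K \<subseteq> I" "finite K" using K less.prems(1) finite_index by auto
      \<comment> \<open>the sign by which \<open>y j\<close> commutes past \<open>monomial M\<close>\<close>
      define s :: "nat \<Rightarrow> nat set \<Rightarrow> 'k" where "s = (\<lambda>j M. (- 1) ^ (card M + card ({j} \<inter> M)))"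
      have conj: "y j * monomial M = sC (s j M) (monomial M * y j)"
        if "j \<in> I" "M \<subseteq> I" for j M
        using monomial_commute[of "{j}" M] that by (simp add: s_def)
      have "\<exists>j\<in>I. odd (card K + card ({j} \<inter> K)) \<noteq> odd (card L + card ({j} \<inter> L))"
      proof (cases "odd (card K) = odd (card L)")
        case True
        obtain j where "j \<in> sym_diff K L" using K(2) by blast
        then show ?thesis using True KN LN by (intro bexI[of _ j]) auto
      next
        case False
        have "card K = card (K - L) + card (K \<inter> L)" "card L = card (L - K) + card (K \<inter> L)"
          using card_Int_Diff[OF KN(2), of L] card_Int_Diff[OF LN(2), of K] by (simp_all add: Int_commute)
        moreover have "card (sym_diff K L) = card (K - L) + card (L - K)"
          using KN LN by (intro card_Un_disjoint) auto
        ultimately have "odd (card (sym_diff K L))" using False by (metis even_add)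
        then have "sym_diff K L \<noteq> I" using even_I by metis
        then obtain j where "j \<in> I" "j \<notin> sym_diff K L" using KN LN by blast
        then show ?thesis using False by (intro bexI[of _ j]) auto
      qed
      then obtain j where j: "j \<in> I" "s j K \<noteq> s j L"
        using one_neq_minus_one unfolding s_def minus_one_power_iff by (metis (full_types))
      define F' where "F' = {M \<in> F. s j M \<noteq> s j L}"
      have "0 = y j * (\<Sum>M\<in>F. sC (a M) (monomial M)) - sC (s j L) ((\<Sum>M\<in>F. sC (a M) (monomial M)) * y j)"
        using less.prems(3) by simp
      also have "\<dots> = (\<Sum>M\<in>F. sC (a M) (y j * monomial M)) - (\<Sum>M\<in>F. sC (s j L) (sC (a M) (monomial M * y j)))"
        by (simp add: sum_distrib_left sum_distrib_right scale_sum_right scale_mult)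
      also have "\<dots> = (\<Sum>M\<in>F. sC (a M * (s j M - s j L)) (monomial M)) * y j"
        unfolding sum_subtractf[symmetric] sum_distrib_right
        using conj[OF j(1)] less.prems(1)
        by (intro sum.cong) (auto simp: scale_mult scale_left_diff_distrib right_diff_distrib left_diff_distrib mult.commute)
      finally have *: "(\<Sum>M\<in>F. sC (a M * (s j M - s j L)) (monomial M)) * y j = 0" by simp
      have "(\<Sum>M\<in>F. sC (a M * (s j M - s j L)) (monomial M)) =
          sC (\<eta> j * \<eta> j) (\<Sum>M\<in>F. sC (a M * (s j M - s j L)) (monomial M))"
        using eta_square[OF j(1)] by simp
      also have "\<dots> = sC (\<eta> j) ((\<Sum>M\<in>F. sC (a M * (s j M - s j L)) (monomial M)) * y j * y j)"
        using gen_square[OF j(1)] by (simp add: mult.assoc scale_mult)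
      also have "\<dots> = 0" by (simp add: *)
      finally have "(\<Sum>M\<in>F'. sC (a M * (s j M - s j L)) (monomial M)) = 0"
        unfolding F'_def using finF by (subst sum.mono_neutral_left[of F]) auto
      moreover have "F' \<subset> F" using L by (auto simp: F'_def)
      moreover have "\<forall>M\<in>F'. a M * (s j M - s j L) \<noteq> 0" using less.prems(2) by (auto simp: F'_def)
      moreover have "K \<in> F'" using K j by (simp add: F'_def)
      moreover have "F' \<subseteq> Pow I" using less.prems(1) by (auto simp: F'_def)
      ultimately show False
        using less.hyps[of F' "\<lambda>M. a M * (s j M - s j L)"] psubset_card_mono[OF finF, of F'] by blast
    qed
  qed
qed

lemma monomials_independent:
  assumes "(\<Sum>K\<in>Pow I. sC (a K) (monomial K)) = 0" "K \<subseteq> I"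
  shows "a K = 0"
proof -
  define F where "F = {K \<in> Pow I. a K \<noteq> 0}"
  have "(\<Sum>K\<in>F. sC (a K) (monomial K)) = 0"
    unfolding F_def using assms(1) by (subst sum.mono_neutral_left[of "Pow I"]) auto
  then have "F = {}" by (intro monomials_independent_support[of F a]) (auto simp: F_def)
  then show ?thesis using assms(2) by (auto simp: F_def)
qed

lemma monomial_expansion_exists: "\<exists>a. c = (\<Sum>K\<in>Pow I. sC (a K) (monomial K))"
proof -
  define W where "W = range (\<lambda>a. \<Sum>K\<in>Pow I. sC (a K) (monomial K))"
  have sub: "subspace W"
  proof (rule subspaceI)
    show "0 \<in> W" unfolding W_def by (rule range_eqI[of _ _ "\<lambda>_. 0"]) simp
    show "x + z \<in> W" if xz: "x \<in> W" "z \<in> W" for x z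
    proof -
      obtain a b where "x = (\<Sum>K\<in>Pow I. sC (a K) (monomial K))" "z = (\<Sum>K\<in>Pow I. sC (b K) (monomial K))"
        using xz unfolding W_def by blast
      then show ?thesis unfolding W_def
        by (intro range_eqI[of _ _ "\<lambda>K. a K + b K"]) (simp add: scale_left_distrib sum.distrib)
    qed
    show "sC r x \<in> W" if x: "x \<in> W" for r x
    proof -
      obtain a where "x = (\<Sum>K\<in>Pow I. sC (a K) (monomial K))"
        using x unfolding W_def by blast
      then show ?thesis unfolding W_def
        by (intro range_eqI[of _ _ "\<lambda>K. r * a K"]) (simp add: scale_sum_right)
    qed
  qed
  have mono: "monomial K \<in> W" if K: "K \<subseteq> I" for K
  proof -
    have "(\<Sum>M\<in>Pow I. sC (if M = K then 1 else 0) (monomial M)) =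
        (\<Sum>M\<in>Pow I. if M = K then monomial M else 0)"
      by (intro sum.cong) auto
    then have "monomial K = (\<Sum>M\<in>Pow I. sC (if M = K then 1 else 0) (monomial M))"
      using K by simp
    then show ?thesis unfolding W_def by (rule range_eqI[where x = "\<lambda>M. if M = K then 1 else 0"])
  qed
  have "W = UNIV"
  proof (rule generate[OF sub])
    show "1 \<in> W" using mono[of "{}"] by simp
    fix i w assume i: "i \<in> I" and "w \<in> W"
    then obtain a where a: "w = (\<Sum>K\<in>Pow I. sC (a K) (monomial K))"
      unfolding W_def by blast
    have "y i * monomial K \<in> W" if K: "K \<subseteq> I" for K
    proof -
      obtain s where "y i * monomial K = sC s (monomial (sym_diff K {i}))"
        using gen_monomial[OF K i] by blast
      moreover have "sym_diff K {i} \<subseteq> I" using K i by auto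
      ultimately show ?thesis using mono subspace_scale[OF sub] by metis
    qed
    then show "y i * w \<in> W" unfolding a sum_distrib_left
      by (intro subspace_sum[OF sub]) (auto simp: scale_mult intro: subspace_scale[OF sub])
  qed
  then show ?thesis unfolding W_def by blast
qed

text \<open>On subsets of \<open>I\<close> the choice is unique by \<open>monomials_independent\<close>.\<close>

definition coef :: "'c \<Rightarrow> nat set \<Rightarrow> 'k" where
  "coef c = (SOME a. c = (\<Sum>K\<in>Pow I. sC (a K) (monomial K)))"

lemma monomial_expansion: "c = (\<Sum>K\<in>Pow I. sC (coef c K) (monomial K))"
  unfolding coef_def by (rule someI_ex[OF monomial_expansion_exists])

lemma coef_unique:
  assumes "c = (\<Sum>K\<in>Pow I. sC (a K) (monomial K))" "K \<subseteq> I"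
  shows "coef c K = a K"
proof -
  have "(\<Sum>K\<in>Pow I. sC (coef c K - a K) (monomial K)) = 0"
    using monomial_expansion[of c] assms(1) by (simp add: scale_left_diff_distrib sum_subtractf)
  from monomials_independent[OF this assms(2)] show ?thesis by simp
qed

lemma coef_add: "K \<subseteq> I \<Longrightarrow> coef (c + d) K = coef c K + coef d K"
  by (rule coef_unique)
     (simp_all add: scale_left_distrib sum.distrib flip: monomial_expansion)

lemma coef_scale: "K \<subseteq> I \<Longrightarrow> coef (sC a c) K = a * coef c K"
  by (rule coef_unique)
     (simp_all flip: scale_scale scale_sum_right monomial_expansion)

lemma coef_monomial: 
  assumes "K \<subseteq> I" "L \<subseteq> I"
  shows "coef (monomial L) K = (if K = L then 1 else 0)"
proof -
  have "(\<Sum>M\<in>Pow I. sC (if M = L then 1 else 0) (monomial M)) =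
        (\<Sum>M\<in>Pow I. if M = L then monomial M else 0)"
    by (intro sum.cong) auto
  then have "monomial L = (\<Sum>M\<in>Pow I. sC (if M = L then 1 else 0) (monomial M))"
    using assms by (simp add: sum.delta)
  then show ?thesis using assms(1) by (rule coef_unique)
qed

lemma coef_zero: "K \<subseteq> I \<Longrightarrow> coef 0 K = 0"
  using coef_scale[of K 0 0] by simp

lemma coef_sum: "K \<subseteq> I \<Longrightarrow> coef (sum f F) K = (\<Sum>i\<in>F. coef (f i) K)"
  by (induction F rule: infinite_finite_induct) (simp_all add: coef_zero coef_add)

lemma coef_minus: "K \<subseteq> I \<Longrightarrow> coef (- c) K = - coef c K"
  using coef_scale[of K "-1" c] by simp

lemma coef_eqI: "(\<And>K. K \<subseteq> I \<Longrightarrow> coef c K = coef d K) \<Longrightarrow> c = d"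
  by (subst monomial_expansion[of c], subst monomial_expansion[of d]) (auto intro!: sum.cong)

text \<open>The matrix trace on \<open>End S\<close> divided by \<open>dim S\<close>, see \<open>tr_rank_one\<close>. Defining it by a coefficient avoids matrices.\<close>

definition tr :: "'c \<Rightarrow> 'k" where
  "tr c = coef c {}"

lemma tr_add: "tr (c + d) = tr c + tr d"
  and tr_scale: "tr (sC a c) = a * tr c"
  and tr_minus: "tr (- c) = - tr c"
  and tr_sum: "tr (sum f F) = (\<Sum>i\<in>F. tr (f i))"
  by (simp_all add: tr_def coef_add coef_scale coef_minus coef_sum)

lemma tr_diff: "tr (c - d) = tr c - tr d"
  using tr_add[of c "- d"] by (simp add: tr_minus)

lemma tr_one: "tr 1 = 1"
  using coef_monomial[of "{}" "{}"] by (simp add: tr_def)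

text \<open>Since \<open>monomial K * monomial L\<close> is a multiple of the monomial of the symmetric difference, monomials are orthogonal for the trace form.\<close>

lemma tr_monomial_mult:
  assumes "K \<subseteq> I" "L \<subseteq> I"
  shows "tr (monomial K * monomial L) = (if K = L then mono_sq K else 0)"
proof (cases "K = L")
  case True
  then show ?thesis using assms by (simp add: monomial_square tr_scale tr_one)
next
  case False
  obtain s where "monomial K * monomial L = sC s (monomial (sym_diff K L))"
    using monomial_mult[OF assms] by blast
  moreover have "{} \<noteq> sym_diff K L" "sym_diff K L \<subseteq> I" using False assms by blast+
  ultimately show ?thesis using False coef_monomial[of "{}" "sym_diff K L"]
    by (simp only: tr_def coef_scale empty_subsetI if_False mult_zero_right)
qed

lemma tr_mult_monomial:
  assumes "K \<subseteq> I"
  shows "tr (c * monomial K) = mono_sq K * coef c K"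
    and "tr (monomial K * c) = mono_sq K * coef c K"
proof -
  have "tr (c * monomial K) = (\<Sum>M\<in>Pow I. coef c M * tr (monomial M * monomial K))"
    by (subst monomial_expansion[of c]) (simp add: sum_distrib_right tr_sum tr_scale scale_mult)
  also have "\<dots> = (\<Sum>M\<in>Pow I. if M = K then mono_sq K * coef c K else 0)"
    using assms by (intro sum.cong) (auto simp: tr_monomial_mult)
  finally show "tr (c * monomial K) = mono_sq K * coef c K" using assms by simp
  have "tr (monomial K * c) = (\<Sum>M\<in>Pow I. coef c M * tr (monomial K * monomial M))"
    by (subst monomial_expansion[of c]) (simp add: sum_distrib_left tr_sum tr_scale scale_mult)
  also have "\<dots> = (\<Sum>M\<in>Pow I. if M = K then mono_sq K * coef c K else 0)"
    using assms by (intro sum.cong) (auto simp: tr_monomial_mult)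
  finally show "tr (monomial K * c) = mono_sq K * coef c K" using assms by simp
qed

lemma tr_commute: "tr (c * d) = tr (d * c)"
proof -
  have "tr (c * d) = (\<Sum>K\<in>Pow I. coef d K * tr (c * monomial K))"
    by (subst monomial_expansion[of d]) (simp add: sum_distrib_left tr_sum tr_scale scale_mult)
  also have "\<dots> = (\<Sum>K\<in>Pow I. coef d K * tr (monomial K * c))"
    by (intro sum.cong) (simp_all add: tr_mult_monomial)
  also have "\<dots> = tr (d * c)"
    by (subst (2) monomial_expansion[of d]) (simp add: sum_distrib_right tr_sum tr_scale scale_mult)
  finally show ?thesis .
qed

lemma coef_eq_tr:
  assumes "K \<subseteq> I"
  shows "coef c K = mono_sq K * tr (c * monomial K)"
  using mono_sq_square[OF assms] by (simp add: tr_mult_monomial[OF assms] mult.assoc[symmetric])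

end

section \<open>The spinor module and the Fierz identity\<close>

text \<open>The dimension of \<open>S\<close> must be invertible in the field, as the trace of a rank-one operator involves its inverse.\<close>

locale spinor_rep = clifford_frame sC y \<eta> I + S: vector_space sS
  for sC :: "'k::field \<Rightarrow> 'c::ring_1 \<Rightarrow> 'c" and y \<eta> I
    and sS :: "'k \<Rightarrow> 's::ab_group_add \<Rightarrow> 's" +
  fixes \<rho> :: "'c \<Rightarrow> 's \<Rightarrow> 's"
  assumes iso: "algebra_iso_End sC sS \<rho>"
    and dim_nonzero: "of_nat (S.dim UNIV) \<noteq> (0::'k)"
begin

lemma rho_add: "\<rho> (c + d) \<psi> = \<rho> c \<psi> + \<rho> d \<psi>"
  and rho_scale: "\<rho> (sC a c) \<psi> = sS a (\<rho> c \<psi>)"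
  and rho_mult: "\<rho> (c * d) \<psi> = \<rho> c (\<rho> d \<psi>)"
  and rho_one: "\<rho> 1 \<psi> = \<psi>"
  using iso by (auto simp: algebra_iso_End_def)

lemma rho_linear: "Vector_Spaces.linear sS sS (\<rho> c)"
  using iso by (auto simp: algebra_iso_End_def bij_betw_def)

lemma rho_inject: "\<rho> c = \<rho> d \<Longrightarrow> c = d"
  using iso by (auto simp: algebra_iso_End_def bij_betw_def dest: injD)

lemma rho_surject: "Vector_Spaces.linear sS sS f \<Longrightarrow> \<exists>c. \<rho> c = f"
  using iso unfolding algebra_iso_End_def bij_betw_def by (metis (no_types, lifting) imageE mem_Collect_eq)

lemma rho_add_right: "\<rho> c (\<phi> + \<psi>) = \<rho> c \<phi> + \<rho> c \<psi>"
  and rho_scale_right: "\<rho> c (sS a \<phi>) = sS a (\<rho> c \<phi>)"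
  using rho_linear[of c] by (auto simp: Vector_Spaces.linear_iff)

lemma rho_zero: "\<rho> 0 \<psi> = 0"
  using rho_scale[of 0 0 \<psi>] by simp

lemma rho_zero_right: "\<rho> c 0 = 0"
  using rho_scale_right[of c 0 0] by simp

lemma rho_minus: "\<rho> (- c) \<psi> = - \<rho> c \<psi>"
  using rho_scale[of "-1" c \<psi>] by simp

lemma rho_minus_right: "\<rho> c (- \<psi>) = - \<rho> c \<psi>"
  using rho_scale_right[of c "-1" \<psi>] by simp

lemma rho_diff_right: "\<rho> c (\<phi> - \<psi>) = \<rho> c \<phi> - \<rho> c \<psi>"
  using rho_add_right[of c \<phi> "- \<psi>"] by (simp add: rho_minus_right)

lemma rho_diff: "\<rho> (c - d) \<psi> = \<rho> c \<psi> - \<rho> d \<psi>"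
  using rho_add[of c "- d" \<psi>] by (simp add: rho_minus)

lemma rho_sum: "\<rho> (sum f F) \<psi> = (\<Sum>i\<in>F. \<rho> (f i) \<psi>)"
  by (induction F rule: infinite_finite_induct) (simp_all add: rho_zero rho_add)

abbreviation functional :: "('s \<Rightarrow> 'k) \<Rightarrow> bool" where
  "functional \<equiv> Vector_Spaces.linear sS (*)"

lemma functional_rho: "functional f \<Longrightarrow> functional (\<lambda>\<psi>. f (\<rho> c \<psi>))"
  by (simp add: Vector_Spaces.linear_iff rho_add_right rho_scale_right)

lemma functional_scale: "functional f \<Longrightarrow> f (sS a \<psi>) = a * f \<psi>"
  and functional_add: "functional f \<Longrightarrow> f (\<phi> + \<psi>) = f \<phi> + f \<psi>"
  by (simp_all add: Vector_Spaces.linear_iff)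

lemma functional_sum: 
  assumes "functional f" 
  shows "f (sum h F) = (\<Sum>i\<in>F. f (h i))"
proof (induction F rule: infinite_finite_induct)
  case empty
  then show ?case using functional_scale[OF assms, of 0 0] by simp
next
  case (infinite F)
  then show ?case using functional_scale[OF assms, of 0 0] by simp
qed (simp add: functional_add[OF assms])

text \<open>The element of \<open>C\<close> acting as \<open>f(-) \<phi>\<close>, for linear \<open>f\<close>; it exists because \<open>\<rho>\<close> is onto.\<close>

definition rank_one :: "'s \<Rightarrow> ('s \<Rightarrow> 'k) \<Rightarrow> 'c" where
  "rank_one \<phi> f = (SOME c. \<forall>\<chi>. \<rho> c \<chi> = sS (f \<chi>) \<phi>)"

lemma rho_rank_one:
  assumes "functional f"
  shows "\<rho> (rank_one \<phi> f) \<chi> = sS (f \<chi>) \<phi>"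
proof -
  have "Vector_Spaces.linear sS sS (\<lambda>\<chi>. sS (f \<chi>) \<phi>)"
    using assms by (simp add: Vector_Spaces.linear_iff S.scale_left_distrib)
  then have "\<exists>c. \<forall>\<chi>. \<rho> c \<chi> = sS (f \<chi>) \<phi>" using rho_surject by metis
  then show ?thesis unfolding rank_one_def by (rule someI2_ex) blast
qed

text \<open>Comparing the two products of rank-one operators under the trace shows \<open>tr (rank_one \<phi> f) = \<mu> f \<phi>\<close> with a
  constant \<open>\<mu>\<close>. Writing the identity as a sum of rank-one operators along a basis and its dual basis gives
  \<open>1 = \<mu> dim S\<close>.\<close>

lemma tr_rank_one:
  assumes f: "functional f"
  shows "tr (rank_one \<phi> f) = f \<phi> / of_nat (S.dim UNIV)"
proof -
  have exchange: "g \<chi> * tr (rank_one \<psi> h) = h \<psi> * tr (rank_one \<chi> g)"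
    if gh: "functional g" "functional h" for \<psi> \<chi> g h
  proof -
    have "rank_one \<psi> g * rank_one \<chi> h = sC (g \<chi>) (rank_one \<psi> h)"
      by (rule rho_inject, rule ext)
         (simp add: rho_mult rho_scale rho_rank_one gh functional_scale mult.commute)
    moreover have "rank_one \<chi> h * rank_one \<psi> g = sC (h \<psi>) (rank_one \<chi> g)"
      by (rule rho_inject, rule ext)
         (simp add: rho_mult rho_scale rho_rank_one gh functional_scale mult.commute)
    ultimately show ?thesis using tr_commute[of "rank_one \<psi> g" "rank_one \<chi> h"] by (simp add: tr_scale)
  qed
  obtain X where X: "S.independent X" "S.span X = UNIV" "card X = S.dim UNIV"
    by (rule S.basis_exists[of UNIV]) auto
  define d where "d = S.dim UNIV"
  have "card X \<noteq> 0" using X dim_nonzero by (metis of_nat_0)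
  then have fin: "finite X" and ne: "X \<noteq> {}" by (auto intro: card_ge_0_finite)
  define p where "p = (\<lambda>b v. S.representation X v b)"
  have p: "functional (p b)" for b
    unfolding p_def by (rule S.linear_representation[OF X(1,2)])
  have pb: "p b b = 1" if "b \<in> X" for b
    using S.representation_basis[OF X(1) that] by (simp add: p_def)
  obtain b where b: "b \<in> X" using ne by blast
  define \<mu> where "\<mu> = tr (rank_one b (p b))"
  have all: "tr (rank_one \<psi> g) = g \<psi> * \<mu>" if "functional g" for \<psi> g
    using exchange[OF p that, of b b \<psi>] pb[OF b] by (simp add: \<mu>_def)
  have "1 = (\<Sum>a\<in>X. rank_one a (p a))"
  proof (rule rho_inject, rule ext)
    fix \<psi>
    show "\<rho> 1 \<psi> = \<rho> (\<Sum>a\<in>X. rank_one a (p a)) \<psi>"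
      using S.sum_representation_eq[OF X(1) _ fin subset_refl, of \<psi>] X(2)
      by (simp add: rho_one rho_sum rho_rank_one p) (simp add: p_def)
  qed
  then have "1 = (\<Sum>a\<in>X. tr (rank_one a (p a)))" using tr_one tr_sum by metis
  also have "\<dots> = (\<Sum>a\<in>X. \<mu>)" by (intro sum.cong) (simp_all add: all p pb)
  finally have "of_nat d * \<mu> = 1" using X(3) by (simp add: d_def)
  then have "\<mu> = 1 / of_nat d" by (metis mult_zero_left nonzero_eq_divide_eq mult.commute zero_neq_one)
  then show ?thesis using all[OF f] by (simp add: d_def)
qed

lemma coef_rank_one:
  assumes "functional f" "K \<subseteq> I"
  shows "coef (rank_one \<phi> f) K = mono_sq K * f (\<rho> (monomial K) \<phi>) / of_nat (S.dim UNIV)"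
proof -
  have "rank_one \<phi> f * monomial K = rank_one \<phi> (\<lambda>\<psi>. f (\<rho> (monomial K) \<psi>))"
    using assms(1)
    by (intro rho_inject ext) (simp add: rho_mult rho_rank_one functional_rho)
  then show ?thesis using assms
    by (simp add: coef_eq_tr tr_rank_one functional_rho)
qed

lemma rho_expansion: "\<rho> c \<chi> = (\<Sum>K\<in>Pow I. sS (coef c K) (\<rho> (monomial K) \<chi>))"
  by (subst monomial_expansion[of c]) (simp add: rho_sum rho_scale)

text \<open>The expansion of a rank-one operator in monomials. The factor \<open>mono_sq K\<close> is there because the coefficient at \<open>K\<close> is a trace against the inverse of \<open>monomial K\<close>.\<close>

lemma fierz:
  assumes "functional f"
  shows "sS (f \<chi>) \<phi> = (\<Sum>K\<in>Pow I.
    sS (mono_sq K * f (\<rho> (monomial K) \<phi>) / of_nat (S.dim UNIV)) (\<rho> (monomial K) \<chi>))"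
proof -
  have "sS (f \<chi>) \<phi> = \<rho> (rank_one \<phi> f) \<chi>" using assms by (simp add: rho_rank_one)
  also have "\<dots> = (\<Sum>K\<in>Pow I. sS (coef (rank_one \<phi> f) K) (\<rho> (monomial K) \<chi>))"
    by (rule rho_expansion)
  finally show ?thesis using assms by (simp add: coef_rank_one)
qed

end

section \<open>Spinor norms\<close>

locale spinor_form = spinor_rep sC y \<eta> I sS \<rho>
  for sC :: "'k::field \<Rightarrow> 'c::ring_1 \<Rightarrow> 'c" and y \<eta> I
    and sS :: "'k \<Rightarrow> 's::ab_group_add \<Rightarrow> 's" and \<rho> +
  fixes B :: "'s \<Rightarrow> 's \<Rightarrow> 'k"
  assumes form: "bilinear_form sS B"
    and form_gen: "i \<in> I \<Longrightarrow> B (\<rho> (y i) \<phi>) \<psi> = B \<phi> (\<rho> (y i) \<psi>)"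
begin

lemma functional_form: "functional (B \<phi>)" "functional (\<lambda>\<phi>. B \<phi> \<psi>)"
  using form by (simp_all add: bilinear_form_def)

lemma form_add: "B (\<phi> + \<psi>) \<chi> = B \<phi> \<chi> + B \<psi> \<chi>" "B \<chi> (\<phi> + \<psi>) = B \<chi> \<phi> + B \<chi> \<psi>"
  and form_scale: "B (sS a \<phi>) \<chi> = a * B \<phi> \<chi>" "B \<chi> (sS a \<phi>) = a * B \<chi> \<phi>"
  using functional_add functional_scale functional_form by blast+

lemma form_minus: "B (- \<phi>) \<chi> = - B \<phi> \<chi>" "B \<chi> (- \<phi>) = - B \<chi> \<phi>"
  using form_scale(1)[of "- 1" \<phi> \<chi>] form_scale(2)[of \<chi> "- 1" \<phi>] by simp_all

lemma form_diff: "B (\<phi> - \<psi>) \<chi> = B \<phi> \<chi> - B \<psi> \<chi>" "B \<chi> (\<phi> - \<psi>) = B \<chi> \<phi> - B \<chi> \<psi>"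
  using form_add(1)[of \<phi> "- \<psi>" \<chi>] form_add(2)[of \<chi> \<phi> "- \<psi>"] by (simp_all add: form_minus)

lemma form_sum: "B (sum f F) \<chi> = (\<Sum>i\<in>F. B (f i) \<chi>)" "B \<chi> (sum f F) = (\<Sum>i\<in>F. B \<chi> (f i))"
  by (simp_all add: functional_sum[OF functional_form(1)] functional_sum[OF functional_form(2)])

text \<open>Adjunction with respect to \<open>B\<close> fixes the generators, so it reverses products.\<close>

lemma form_monomial:
  assumes "K \<subseteq> I"
  shows "B (\<rho> (monomial K) \<phi>) \<psi> = swap_sign (card K) * B \<phi> (\<rho> (monomial K) \<psi>)"
  using assms
proof (induction arbitrary: \<phi> \<psi> rule: index_set_induct)
  case empty
  then show ?case by (simp add: rho_one swap_sign_def numeral_2_eq_2)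
next
  case (insert b K)
  have "y b * monomial K = sC ((- 1) ^ card K) (monomial K * y b)"
    using insert by (intro gen_monomial_commute_notin) auto
  then have "\<rho> (y b * monomial K) \<psi> = \<rho> (sC ((- 1) ^ card K) (monomial K * y b)) \<psi>"
    by (rule arg_cong)
  then have "\<rho> (monomial K) (\<rho> (y b) \<psi>) = sS ((- 1) ^ card K) (\<rho> (y b) (\<rho> (monomial K) \<psi>))"
    by (simp add: rho_mult rho_scale flip: power_mult_distrib)
  then show ?case using insert
    by (simp add: monomial_insert_min rho_mult form_gen form_scale swap_sign_Suc mult_ac)
qed

text \<open>Let \<open>\<psi>\<close> run through a basis in the Fierz identity and contract with the dual basis. The left side becomes
  \<open>B \<phi> \<chi>\<close>. On the right, moving \<open>monomial K\<close> to the other side of \<open>B\<close> turns every summand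
  into a reversal sign times \<open>B \<chi> \<phi>\<close>, divided by \<open>dim S\<close>. This is the comparison of the trace of the
  reversal on \<open>C\<close> with the trace of the swap on \<open>S \<otimes> S\<close>.\<close>

lemma form_swap:
  "B \<phi> \<chi> = (\<Sum>K\<in>Pow I. swap_sign (card K)) / of_nat (S.dim UNIV) * B \<chi> \<phi>"
proof -
  define d where "d = (of_nat (S.dim UNIV) :: 'k)"
  obtain X where X: "S.independent X" "S.span X = UNIV" "card X = S.dim UNIV"
    by (rule S.basis_exists[of UNIV]) auto
  have "card X \<noteq> 0" using X dim_nonzero by (metis of_nat_0)
  then have fin: "finite X" by (auto intro: card_ge_0_finite)
  define p where "p = (\<lambda>b v. S.representation X v b)"
  have p: "functional (p b)" for b
    unfolding p_def by (rule S.linear_representation[OF X(1,2)])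
  then have p_lin: "p b (sS r v) = r * p b v" "p b (sum h F) = (\<Sum>i\<in>F. p b (h i))" for b r v and F and h :: "nat set \<Rightarrow> 's"
    using functional_scale[OF p] functional_sum[OF p] by simp_all
  have contract: "(\<Sum>a\<in>X. g a * p a v) = g v" if "functional g" for g v
  proof -
    have "g (\<Sum>a\<in>X. sS (p a v) a) = (\<Sum>a\<in>X. p a v * g a)"
      using that by (simp add: functional_sum functional_scale)
    moreover have "(\<Sum>a\<in>X. sS (p a v) a) = v"
      using S.sum_representation_eq[OF X(1) _ fin subset_refl, of v] X(2) by (simp add: p_def)
    ultimately show ?thesis by (simp add: mult.commute)
  qed
  have "B \<phi> \<chi> = (\<Sum>a\<in>X. B a \<chi> * p a \<phi>)"
    by (rule contract[symmetric]) (rule functional_form)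
  also have "\<dots> = (\<Sum>a\<in>X. p a (sS (B a \<chi>) \<phi>))" by (simp add: p_lin)
  also have "\<dots> = (\<Sum>a\<in>X. \<Sum>K\<in>Pow I. mono_sq K * B a (\<rho> (monomial K) \<phi>) / d * p a (\<rho> (monomial K) \<chi>))"
    unfolding fierz[OF functional_form(1), of _ \<chi> \<phi>] p_lin d_def ..
  also have "\<dots> = (\<Sum>K\<in>Pow I. mono_sq K / d * (\<Sum>a\<in>X. B a (\<rho> (monomial K) \<phi>) * p a (\<rho> (monomial K) \<chi>)))"
    by (subst sum.swap) (simp add: sum_distrib_left mult_ac)
  also have "\<dots> = (\<Sum>K\<in>Pow I. mono_sq K / d * B (\<rho> (monomial K) \<chi>) (\<rho> (monomial K) \<phi>))"
    by (simp add: contract functional_form)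
  also have "\<dots> = (\<Sum>K\<in>Pow I. swap_sign (card K) / d * B \<chi> \<phi>)"
  proof (rule sum.cong[OF refl])
    fix K assume "K \<in> Pow I"
    then have K: "K \<subseteq> I" by simp
    have "\<rho> (monomial K) (\<rho> (monomial K) \<phi>) = sS (mono_sq K) \<phi>"
      using monomial_square[OF K] by (simp add: rho_scale rho_one flip: rho_mult)
    then have "mono_sq K / d * B (\<rho> (monomial K) \<chi>) (\<rho> (monomial K) \<phi>) =
        (mono_sq K * mono_sq K) * swap_sign (card K) / d * B \<chi> \<phi>"
      by (simp add: form_monomial[OF K] form_scale)
    then show "mono_sq K / d * B (\<rho> (monomial K) \<chi>) (\<rho> (monomial K) \<phi>) = swap_sign (card K) / d * B \<chi> \<phi>"
      by (simp add: mono_sq_square[OF K])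
  qed
  finally show ?thesis by (simp add: sum_distrib_right sum_divide_distrib d_def)
qed

end

section \<open>Bivectors\<close>

lemma power_minus_one_eq_diff: "(- 1) ^ k = (1 :: 'a::comm_ring_1) - 2 * of_bool (odd k)"
  by simp

text \<open>The two-element sets with an odd number of elements in \<open>K\<close> are the pairs joining \<open>K\<close> to its complement.\<close>

lemma sum_pairs_sign:
  assumes "finite I" "K \<subseteq> I"
  shows "(\<Sum>P | P \<subseteq> I \<and> card P = 2. (- 1) ^ card (P \<inter> K)) =
    (of_nat (card I choose 2) - 2 * of_nat (card K * card (I - K)) :: 'a::comm_ring_1)"
proof -
  let ?Q = "{P. P \<subseteq> I \<and> card P = 2}"
  have finQ: "finite ?Q" using assms(1) by simp
  have bij: "bij_betw (\<lambda>(a, b). {a, b}) (K \<times> (I - K)) {P \<in> ?Q. odd (card (P \<inter> K))}"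
  proof (rule bij_betw_imageI)
    show "inj_on (\<lambda>(a, b). {a, b}) (K \<times> (I - K))"
      by (auto simp: inj_on_def doubleton_eq_iff)
    show "(\<lambda>(a, b). {a, b}) ` (K \<times> (I - K)) = {P \<in> ?Q. odd (card (P \<inter> K))}"
    proof (intro equalityI subsetI)
      fix P assume "P \<in> (\<lambda>(a, b). {a, b}) ` (K \<times> (I - K))"
      then obtain a b where ab: "P = {a, b}" "a \<in> K" "b \<in> I" "b \<notin> K" by auto
      then have "P \<inter> K = {a}" "a \<noteq> b" by auto
      then show "P \<in> {P \<in> ?Q. odd (card (P \<inter> K))}" using ab assms(2) by auto
    next
      fix P assume P: "P \<in> {P \<in> ?Q. odd (card (P \<inter> K))}"
      then obtain a b where ab: "P = {a, b}" "a \<noteq> b" by (auto simp: card_2_iff)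
      have odd: "odd (card (P \<inter> K))" "a \<in> I" "b \<in> I" using P ab by auto
      have "P \<inter> K = P" if "a \<in> K" "b \<in> K" using that ab by auto
      moreover have "P \<inter> K = {}" if "a \<notin> K" "b \<notin> K" using that ab by auto
      moreover have "card P = 2" using ab by simp
      ultimately have "a \<in> K \<and> b \<in> I - K \<or> b \<in> K \<and> a \<in> I - K"
        using odd by (metis DiffI card.empty even_numeral even_zero)
      then have "(a, b) \<in> K \<times> (I - K) \<or> (b, a) \<in> K \<times> (I - K)" by simp
      moreover have "P = (\<lambda>(a, b). {a, b}) (a, b)" "P = (\<lambda>(a, b). {a, b}) (b, a)"
        using ab by auto
      ultimately show "P \<in> (\<lambda>(a, b). {a, b}) ` (K \<times> (I - K))" by (metis imageI)
    qed
  qed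
  then have odd: "card {P \<in> ?Q. odd (card (P \<inter> K))} = card K * card (I - K)"
    using bij_betw_same_card[OF bij] by (simp add: card_cartesian_product)
  have "(\<Sum>P\<in>?Q. (- 1) ^ card (P \<inter> K)) = (\<Sum>P\<in>?Q. 1 - 2 * of_bool (odd (card (P \<inter> K))) :: 'a)"
    by (simp only: power_minus_one_eq_diff)
  also have "\<dots> = of_nat (card ?Q) - 2 * of_nat (card {P \<in> ?Q. odd (card (P \<inter> K))})"
  proof -
    have "(\<Sum>P\<in>?Q. of_bool (odd (card (P \<inter> K)))) = (of_nat (card {P \<in> ?Q. odd (card (P \<inter> K))}) :: 'a)"
      unfolding of_bool_def sum.inter_filter[OF finQ, symmetric] by simp
    then show ?thesis unfolding sum_subtractf sum_distrib_left[symmetric] by simp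
  qed
  finally show ?thesis by (simp only: odd n_subsets[OF assms(1)])
qed

context clifford_frame
begin

definition pairs :: "nat set set" where
  "pairs = {P. P \<subseteq> I \<and> card P = 2}"

definition bivectors :: "'c set" where
  "bivectors = span (monomial ` pairs)"

abbreviation commutator :: "'c \<Rightarrow> 'c \<Rightarrow> 'c" where
  "commutator c d \<equiv> c * d - d * c"

lemma pairsD: "P \<in> pairs \<Longrightarrow> P \<subseteq> I" "P \<in> pairs \<Longrightarrow> card P = 2" "P \<in> pairs \<Longrightarrow> finite P"
  using finite_index by (auto simp: pairs_def)

lemma finite_pairs [simp]: "finite pairs"
  by (simp add: pairs_def)

lemma pairs_commute:
  assumes "P \<in> pairs" "K \<subseteq> I"
  shows "monomial P * monomial K = sC ((- 1) ^ card (P \<inter> K)) (monomial K * monomial P)"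
  using monomial_commute[of P K] assms by (simp add: pairs_def power_add)

lemma subspace_bivectors: "subspace bivectors"
  by (simp add: bivectors_def)

lemma monomial_in_bivectors: "P \<in> pairs \<Longrightarrow> monomial P \<in> bivectors"
  by (simp add: bivectors_def span_base)

lemma coef_bivector:
  assumes "A \<in> bivectors" "K \<subseteq> I" "K \<notin> pairs"
  shows "coef A K = 0"
  using assms(1) unfolding bivectors_def
proof (induction rule: span_induct_alt)
  case base
  then show ?case using assms by (simp add: coef_zero)
next
  case (step a P d)
  then obtain Q where "P = monomial Q" "Q \<in> pairs" by blast
  then show ?case using step assms by (auto simp: coef_add coef_scale coef_monomial pairsD)
qed

lemma bivector_expansion:
  assumes "A \<in> bivectors"
  shows "A = (\<Sum>P\<in>pairs. sC (coef A P) (monomial P))"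
proof -
  have "A = (\<Sum>K\<in>Pow I. sC (coef A K) (monomial K))" by (rule monomial_expansion)
  also have "\<dots> = (\<Sum>P\<in>pairs. sC (coef A P) (monomial P))"
    by (intro sum.mono_neutral_right) (auto simp: coef_bivector[OF assms] pairsD dest: pairsD)
  finally show ?thesis .
qed

lemma bivector_sumI: "(\<Sum>P\<in>pairs. sC (a P) (monomial P)) \<in> bivectors"
  by (intro subspace_sum[OF subspace_bivectors] subspace_scale[OF subspace_bivectors] monomial_in_bivectors)

lemma coef_pair_sum:
  assumes "K \<subseteq> I"
  shows "coef (\<Sum>P\<in>pairs. sC (a P) (monomial P)) K = (if K \<in> pairs then a K else 0)"
proof -
  have "coef (\<Sum>P\<in>pairs. sC (a P) (monomial P)) K = (\<Sum>P\<in>pairs. if P = K then a P else 0)"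
    unfolding coef_sum[OF assms] coef_scale[OF assms]
    using assms by (intro sum.cong) (auto simp: coef_monomial pairsD)
  then show ?thesis by simp
qed

lemma dim_bivectors: "dim bivectors = card I choose 2"
proof -
  have inj: "inj_on monomial pairs"
  proof (rule inj_onI)
    fix P Q assume PQ: "P \<in> pairs" "Q \<in> pairs" "monomial P = monomial Q"
    then have "coef (monomial Q) P = 1" using coef_monomial[of P P] by (simp add: pairsD)
    then show "P = Q" using coef_monomial[of P Q] PQ by (simp add: pairsD split: if_splits)
  qed
  have "independent (monomial ` pairs)"
  proof (rule independent_if_scalars_zero)
    show "finite (monomial ` pairs)" by simp
    fix f c assume f: "(\<Sum>x\<in>monomial ` pairs. sC (f x) x) = 0" and "c \<in> monomial ` pairs"
    then obtain P where P: "c = monomial P" "P \<in> pairs" by blast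
    have "(\<Sum>Q\<in>pairs. sC (f (monomial Q)) (monomial Q)) = 0" using f inj by (simp add: sum.reindex)
    then have "coef (\<Sum>Q\<in>pairs. sC (f (monomial Q)) (monomial Q)) P = 0"
      using P by (simp add: coef_zero pairsD)
    then show "f c = 0" using P by (simp add: coef_pair_sum pairsD)
  qed
  then have "dim bivectors = card (monomial ` pairs)"
    unfolding bivectors_def by (rule dim_span_eq_card_independent)
  also have "\<dots> = card I choose 2"
    using card_image[OF inj] n_subsets[OF finite_I] by (simp add: pairs_def)
  finally show ?thesis .
qed

lemma card_sym_diff:
  assumes "finite P" "finite Q"
  shows "card (sym_diff P Q) + 2 * card (P \<inter> Q) = card P + card Q"
proof -
  have "card (sym_diff P Q) = card (P - Q) + card (Q - P)"
    using assms by (intro card_Un_disjoint) auto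
  then show ?thesis
    using card_Int_Diff[OF assms(1), of Q] card_Int_Diff[OF assms(2), of P] by (simp add: Int_commute)
qed

text \<open>Two such monomials commute unless their index sets share exactly one element; then the symmetric difference has two elements again.\<close>

lemma commutator_pairs:
  assumes "P \<in> pairs" "Q \<in> pairs"
  shows "commutator (monomial P) (monomial Q) \<in> bivectors"
proof (cases "even (card (P \<inter> Q))")
  case True
  then have "commutator (monomial P) (monomial Q) = 0"
    using pairs_commute[OF assms(1), of Q] assms(2) by (simp add: pairsD)
  then show ?thesis using subspace_0[OF subspace_bivectors] by simp
next
  case False
  have "card (P \<inter> Q) \<le> 2" using card_mono[of P "P \<inter> Q"] pairsD[OF assms(1)] by simp
  then have "card (P \<inter> Q) = 1" using False by (cases "card (P \<inter> Q)") auto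
  then have "sym_diff P Q \<in> pairs"
    using card_sym_diff[of P Q] pairsD[OF assms(1)] pairsD[OF assms(2)] by (auto simp: pairs_def)
  moreover obtain s where "monomial P * monomial Q = sC s (monomial (sym_diff P Q))"
    using monomial_mult pairsD(1) assms by blast
  ultimately have *: "monomial P * monomial Q \<in> bivectors"
    using subspace_scale[OF subspace_bivectors monomial_in_bivectors] by metis
  have "monomial Q * monomial P = - (monomial P * monomial Q)"
    using pairs_commute[OF assms(1), of Q] False assms(2) by (simp add: pairsD)
  then show ?thesis using subspace_add[OF subspace_bivectors * *] by simp
qed

lemma commutator_bivectors:
  assumes "A \<in> bivectors" "A' \<in> bivectors"
  shows "commutator A A' \<in> bivectors"
proof -
  have 1: "commutator (monomial P) A' \<in> bivectors" if P: "P \<in> pairs" for P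
  proof -
    have "commutator (monomial P) A' = (\<Sum>Q\<in>pairs. sC (coef A' Q) (commutator (monomial P) (monomial Q)))"
      by (subst (1 2) bivector_expansion[OF assms(2)])
         (simp add: sum_distrib_left sum_distrib_right scale_mult sum_subtractf scale_right_diff_distrib)
    then show ?thesis
      by (simp only:) (intro subspace_sum[OF subspace_bivectors] subspace_scale[OF subspace_bivectors] commutator_pairs P)
  qed
  have "commutator A A' = (\<Sum>P\<in>pairs. sC (coef A P) (commutator (monomial P) A'))"
    by (subst (1 2) bivector_expansion[OF assms(1)])
       (simp add: sum_distrib_left sum_distrib_right scale_mult sum_subtractf scale_right_diff_distrib)
  then show ?thesis
    by (simp only:) (intro subspace_sum[OF subspace_bivectors] subspace_scale[OF subspace_bivectors] 1)
qed

text \<open>Since \<open>mono_sq P\<close> times \<open>monomial P\<close> is the inverse of \<open>monomial P\<close>, every summand is a conjugate of \<open>monomial K\<close>, hence \<open>monomial K\<close> up to sign; the eigenvalue counts these signs.\<close>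

lemma sandwich_monomial:
  assumes "K \<subseteq> I"
  shows "(\<Sum>P\<in>pairs. sC (mono_sq P) (monomial P * monomial K * monomial P)) =
    sC (of_nat (card I choose 2) - 2 * of_nat (card K * (card I - card K))) (monomial K)"
proof -
  have "sC (mono_sq P) (monomial P * monomial K * monomial P) = sC ((- 1) ^ card (P \<inter> K)) (monomial K)"
    if P: "P \<in> pairs" for P
  proof -
    have "monomial P * monomial K * monomial P =
        sC ((- 1) ^ card (P \<inter> K)) (monomial K * (monomial P * monomial P))"
      by (simp only: pairs_commute[OF P assms] scale_mult mult.assoc)
    then have "sC (mono_sq P) (monomial P * monomial K * monomial P) =
        sC (mono_sq P * ((- 1) ^ card (P \<inter> K) * mono_sq P)) (monomial K)"
      by (simp only: monomial_square pairsD(1)[OF P] scale_mult mult_1_right scale_scale)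
    also have "mono_sq P * ((- 1) ^ card (P \<inter> K) * mono_sq P) = (- 1) ^ card (P \<inter> K) * (mono_sq P * mono_sq P)"
      by (rule mult.left_commute)
    finally show ?thesis by (simp only: mono_sq_square pairsD(1)[OF P] mult_1_right)
  qed
  then have "(\<Sum>P\<in>pairs. sC (mono_sq P) (monomial P * monomial K * monomial P)) =
      sC (\<Sum>P\<in>pairs. (- 1) ^ card (P \<inter> K)) (monomial K)"
    by (simp add: scale_sum_left)
  also have "(\<Sum>P\<in>pairs. (- 1) ^ card (P \<inter> K)) =
      (of_nat (card I choose 2) - 2 * of_nat (card K * (card I - card K)) :: 'k)"
    unfolding pairs_def sum_pairs_sign[OF finite_I assms]
      card_Diff_subset[OF finite_index[OF assms] assms] ..
  finally show ?thesis .
qed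

text \<open>The trace of \<open>y j * q * y j * monomial K\<close>, computed in two ways, kills the coefficient at \<open>K\<close> as soon as some \<open>y j\<close> commutes with \<open>monomial K\<close>. Only \<open>K = I\<close> admits no such \<open>j\<close>.\<close>

lemma anticommuting_top:
  assumes "\<And>j. j \<in> I \<Longrightarrow> y j * q = - (q * y j)"
  shows "q = sC (coef q I) (monomial I)"
proof (rule coef_eqI)
  fix K assume K: "K \<subseteq> I"
  show "coef q K = coef (sC (coef q I) (monomial I)) K"
  proof (cases "K = I")
    case False
    \<comment> \<open>a generator that commutes with \<open>monomial K\<close>\<close>
    have "\<exists>j\<in>I. even (card K + card ({j} \<inter> K))"
    proof (cases "even (card K)")
      case True
      obtain j where "j \<in> I" "j \<notin> K" using False K by blast
      then show ?thesis using True by (intro bexI[of _ j]) auto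
    next
      case odd: False
      then have "K \<noteq> {}" by auto
      then obtain j where "j \<in> K" by blast
      then show ?thesis using odd K by (intro bexI[of _ j]) auto
    qed
    then obtain j where j: "j \<in> I" "even (card K + card ({j} \<inter> K))" by blast
    have comm: "y j * monomial K = monomial K * y j"
      using monomial_commute[of "{j}" K] j K by simp
    have "tr (y j * q * y j * monomial K) = - (\<eta> j * tr (q * monomial K))"
      by (simp add: assms[OF j(1)] mult.assoc gen_left_square j(1) scale_mult tr_minus tr_scale)
    moreover have "tr (y j * q * y j * monomial K) = tr (q * (y j * monomial K) * y j)"
      using tr_commute[of "y j" "q * y j * monomial K"] by (simp add: mult.assoc)
    then have "tr (y j * q * y j * monomial K) = \<eta> j * tr (q * monomial K)"
      by (simp add: comm mult.assoc gen_square j(1) scale_mult tr_scale)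
    ultimately have "2 * (\<eta> j * tr (q * monomial K)) = 0" by simp
    then have "tr (q * monomial K) = 0" using two_nonzero eta_square[OF j(1)] by auto
    then show ?thesis using False K by (simp add: coef_eq_tr[of K q] coef_scale coef_monomial)
  qed (simp add: coef_scale coef_monomial)
qed

end

section \<open>Ideals of the Lie algebra of bivectors\<close>

context clifford_frame
begin

text \<open>The square of \<open>ad (monomial P)\<close>. It is diagonal on monomials, unlike \<open>ad (monomial P)\<close> itself.\<close>

definition ad2 :: "nat set \<Rightarrow> 'c \<Rightarrow> 'c" where
  "ad2 P A = commutator (monomial P) (commutator (monomial P) A)"

lemma ad2_monomial:
  assumes P: "P \<in> pairs" and K: "K \<subseteq> I"
  shows "ad2 P (monomial K) = sC (if odd (card (P \<inter> K)) then 4 * mono_sq P else 0) (monomial K)"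
proof -
  define s where "s = (- 1 :: 'k) ^ card (P \<inter> K)"
  have PK: "monomial P * monomial K = sC s (monomial K * monomial P)"
    unfolding s_def by (rule pairs_commute[OF P K])
  have PP: "monomial K * (monomial P * monomial P) = sC (mono_sq P) (monomial K)"
    by (simp add: monomial_square pairsD(1)[OF P] scale_mult)
  have 1: "commutator (monomial P) (monomial K) = sC (s - 1) (monomial K * monomial P)"
    by (simp add: PK scale_left_diff_distrib)
  have "monomial P * (monomial K * monomial P) = sC s (monomial K * (monomial P * monomial P))"
    by (simp only: mult.assoc[symmetric] PK) (simp only: scale_mult mult.assoc)
  then have "commutator (monomial P) (monomial K * monomial P) = sC (s - 1) (sC (mono_sq P) (monomial K))"
    by (simp only: mult.assoc PP scale_left_diff_distrib scale_one)
  then have "ad2 P (monomial K) = sC ((s - 1) * ((s - 1) * mono_sq P)) (monomial K)"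
    unfolding ad2_def 1 by (simp only: scale_mult flip: scale_right_diff_distrib) simp
  also have "(s - 1) * ((s - 1) * mono_sq P) = (if odd (card (P \<inter> K)) then 4 * mono_sq P else 0)"
    by (simp add: s_def)
  finally show ?thesis .
qed

lemma coef_ad2:
  assumes P: "P \<in> pairs" and K: "K \<subseteq> I"
  shows "coef (ad2 P A) K = (if odd (card (P \<inter> K)) then 4 * mono_sq P * coef A K else 0)"
proof -
  have "ad2 P A = (\<Sum>M\<in>Pow I. sC (coef A M) (ad2 P (monomial M)))"
    unfolding ad2_def
    by (subst (1 2 3 4) monomial_expansion[of A])
       (simp add: sum_distrib_left sum_distrib_right scale_mult sum_subtractf scale_right_diff_distrib
         left_diff_distrib right_diff_distrib)
  also have "\<dots> = (\<Sum>M\<in>Pow I. sC (if odd (card (P \<inter> M)) then 4 * mono_sq P * coef A M else 0) (monomial M))"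
    by (intro sum.cong) (auto simp: ad2_monomial[OF P] mult_ac)
  finally show ?thesis using K by (rule coef_unique)
qed

lemma ad2_ad2:
  assumes P: "P \<in> pairs"
  shows "ad2 P (ad2 P A) = sC (4 * mono_sq P) (ad2 P A)"
  by (rule coef_eqI) (simp add: coef_ad2[OF P] coef_scale)

text \<open>An element of the ideal with minimal support is a multiple of one monomial. If its support contains \<open>P \<noteq> Q\<close>,
  choose \<open>a \<in> P - Q\<close> and an index \<open>c\<close> outside \<open>P \<union> Q\<close>: then \<open>{a, c}\<close> meets \<open>P\<close> once and \<open>Q\<close> not at
  all, so \<open>ad2 {a, c}\<close> removes \<open>Q\<close> from the support and keeps \<open>P\<close>. The bound on \<open>card I\<close> provides \<open>c\<close>.\<close>

lemma bivector_ideal_has_pair: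
  assumes large: "4 < card I"
    and zero: "J \<subseteq> bivectors" "A \<in> J" "A \<noteq> 0"
    and scale: "\<And>a X. X \<in> J \<Longrightarrow> sC a X \<in> J"
    and ideal: "\<And>X Z. X \<in> J \<Longrightarrow> Z \<in> bivectors \<Longrightarrow> commutator Z X \<in> J"
  shows "\<exists>P\<in>pairs. monomial P \<in> J"
proof -
  define supp where "supp = (\<lambda>X. {P \<in> pairs. coef X P \<noteq> 0})"
  have fin: "finite (supp X)" for X by (simp add: supp_def)
  obtain X where X: "X \<in> J" "X \<noteq> 0" and min: "\<And>Z. Z \<in> J \<Longrightarrow> Z \<noteq> 0 \<Longrightarrow> card (supp X) \<le> card (supp Z)"
    using ex_has_least_nat[of "\<lambda>X. X \<in> J \<and> X \<noteq> 0" A "\<lambda>X. card (supp X)"] zero(2,3) by blast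
  have XB: "X \<in> bivectors" using X zero(1) by blast
  have "supp X \<noteq> {}"
  proof
    assume "supp X = {}"
    then have "(\<Sum>P\<in>pairs. sC (coef X P) (monomial P)) = 0" by (auto simp: supp_def intro!: sum.neutral)
    then show False using bivector_expansion[OF XB] X(2) by simp
  qed
  then obtain P where P: "P \<in> supp X" by blast
  then have PP: "P \<in> pairs" "coef X P \<noteq> 0" by (auto simp: supp_def)
  have "supp X = {P}"
  proof (rule ccontr)
    assume "supp X \<noteq> {P}"
    then obtain Q where Q: "Q \<in> supp X" "Q \<noteq> P" using P by blast
    then have QQ: "Q \<in> pairs" by (auto simp: supp_def)
    have "\<not> P \<subseteq> Q" using Q(2) card_subset_eq[of Q P] pairsD[OF PP(1)] pairsD[OF QQ] by auto
    then obtain a where a: "a \<in> P" "a \<notin> Q" by blast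
    have "card (P \<union> Q) \<le> 4" using card_Un_le[of P Q] pairsD(2) PP QQ by simp
    then have "P \<union> Q \<noteq> I" using large by auto
    then obtain c where c: "c \<in> I" "c \<notin> P" "c \<notin> Q" using pairsD(1) PP(1) QQ by blast
    have R: "{a, c} \<in> pairs" using a c pairsD(1)[OF PP(1)] by (auto simp: pairs_def card_2_iff)
    have RP: "{a, c} \<inter> P = {a}" and RQ: "{a, c} \<inter> Q = {}" using a c by auto
    define Z where "Z = ad2 {a, c} X"
    have "Z \<in> J" unfolding Z_def ad2_def
      using X(1) monomial_in_bivectors[OF R] by (intro ideal)
    have "(4::'k) = 2 * 2" by simp
    then have four: "(4::'k) \<noteq> 0" using two_nonzero by (metis mult_eq_0_iff)
    have "mono_sq {a, c} \<noteq> 0" using mono_sq_square[OF pairsD(1)[OF R]] by auto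
    then have "coef Z P \<noteq> 0" using PP four by (simp add: Z_def coef_ad2[OF R] pairsD RP)
    then have "Z \<noteq> 0" using PP(1) by (auto simp: coef_zero pairsD)
    have "coef Z Q = 0" using QQ by (simp add: Z_def coef_ad2[OF R] pairsD RQ)
    then have "supp Z \<subseteq> supp X - {Q}" by (auto simp: supp_def Z_def coef_ad2[OF R] pairsD split: if_splits)
    then have "card (supp Z) < card (supp X)"
      using card_mono[of "supp X - {Q}" "supp Z"] fin Q(1) card_Diff1_less[of "supp X" Q] by fastforce
    then show False using min[OF \<open>Z \<in> J\<close> \<open>Z \<noteq> 0\<close>] by simp
  qed
  then have "coef X Q = 0" if "Q \<in> pairs" "Q \<noteq> P" for Q using that by (auto simp: supp_def)
  then have "(\<Sum>Q\<in>pairs. sC (coef X Q) (monomial Q)) = (\<Sum>Q\<in>{P}. sC (coef X Q) (monomial Q))"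
    using PP(1) by (intro sum.mono_neutral_right) auto
  then have "X = sC (coef X P) (monomial P)" using bivector_expansion[OF XB] by simp
  then have "monomial P = sC (1 / coef X P) X" using PP(2)
    by (metis nonzero_eq_divide_eq scale_one scale_scale)
  then show ?thesis using scale[OF X(1)] PP(1) by metis
qed

text \<open>With \<open>R\<close> the symmetric difference of \<open>P\<close> and \<open>Q\<close>, the commutator of \<open>monomial R\<close> and \<open>monomial P\<close> is \<open>\<plusminus>2\<close> times \<open>monomial Q\<close>.\<close>

lemma bivector_ideal_spread:
  assumes scale: "\<And>a X. X \<in> J \<Longrightarrow> sC a X \<in> J"
    and ideal: "\<And>X Z. X \<in> J \<Longrightarrow> Z \<in> bivectors \<Longrightarrow> commutator Z X \<in> J"
    and P: "P \<in> pairs" "monomial P \<in> J" and Q: "Q \<in> pairs" "card (P \<inter> Q) = 1"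
  shows "monomial Q \<in> J"
proof -
  define R where "R = sym_diff P Q"
  have fin: "finite P" "finite Q" using P Q by (simp_all add: pairsD)
  have R: "R \<in> pairs"
    using card_sym_diff[OF fin] P Q pairsD(1)[OF P(1)] pairsD(1)[OF Q(1)] pairsD(2)[OF P(1)] pairsD(2)[OF Q(1)]
    by (auto simp: pairs_def R_def)
  have "sym_diff R P = Q" by (auto simp: R_def)
  then obtain r where r: "r * r = 1" "monomial R * monomial P = sC r (monomial Q)"
    using monomial_mult[OF pairsD(1)[OF R] pairsD(1)[OF P(1)]] by auto
  have "card (sym_diff R P) + 2 * card (R \<inter> P) = 4"
    using card_sym_diff[of R P] R P by (simp add: pairsD)
  then have "card (R \<inter> P) = 1" using \<open>sym_diff R P = Q\<close> pairsD(2)[OF Q(1)] by simp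
  then have "monomial R * monomial P = - (monomial P * monomial R)"
    using pairs_commute[OF R pairsD(1)[OF P(1)]] by simp
  then have "commutator (monomial R) (monomial P) = sC 2 (monomial R * monomial P)"
    by (metis diff_minus_eq_add minus_minus one_add_one scale_left_distrib scale_one)
  then have "sC (2 * r) (monomial Q) \<in> J"
    using ideal[OF P(2) monomial_in_bivectors[OF R]] r by simp
  from scale[OF this, of "r / 2"] show ?thesis using r(1) two_nonzero by (simp add: mult.commute)
qed

lemma bivector_ideal_full:
  assumes large: "4 < card I"
    and J: "J \<subseteq> bivectors" "A \<in> J" "A \<noteq> 0"
    and sub: "subspace J"
    and ideal: "\<And>X Z. X \<in> J \<Longrightarrow> Z \<in> bivectors \<Longrightarrow> commutator Z X \<in> J"
  shows "J = bivectors"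
proof -
  note scale = subspace_scale[OF sub]
  obtain P where P: "P \<in> pairs" "monomial P \<in> J"
    using bivector_ideal_has_pair[OF large J scale ideal] by blast
  have all: "monomial Q \<in> J" if Q: "Q \<in> pairs" for Q
  proof -
    have "card (P \<inter> Q) \<le> 2" using card_mono[of P "P \<inter> Q"] P(1) by (simp add: pairsD)
    then consider "card (P \<inter> Q) = 0" | "card (P \<inter> Q) = 1" | "card (P \<inter> Q) = 2" by linarith
    then show ?thesis
    proof cases
      case 1
      then have disj: "P \<inter> Q = {}" using P(1) by (simp add: pairsD)
      \<comment> \<open>disjoint \<open>P\<close> and \<open>Q\<close> are joined by a two-element set that meets each of them once\<close>
      obtain p q where pq: "p \<in> P" "q \<in> Q" using pairsD(2) P(1) Q by (metis card.empty ex_in_conv zero_neq_numeral)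
      then have "p \<noteq> q" using disj by blast
      then have R: "{p, q} \<in> pairs" using pq pairsD(1) P(1) Q by (auto simp: pairs_def card_2_iff)
      have "P \<inter> {p, q} = {p}" "{p, q} \<inter> Q = {q}" using pq disj by auto
      then show ?thesis
        using bivector_ideal_spread[of J, OF scale ideal R bivector_ideal_spread[of J, OF scale ideal P R] Q] by simp
    next
      case 2
      then show ?thesis using bivector_ideal_spread[of J, OF scale ideal P Q] by simp
    next
      case 3
      have "P \<inter> Q = P" using P(1) 3 card_subset_eq[of P "P \<inter> Q"] by (simp add: pairsD)
      moreover have "P \<inter> Q = Q" using Q 3 card_subset_eq[of Q "P \<inter> Q"] by (simp add: pairsD)
      ultimately show ?thesis using P(2) by simp
    qed
  qed
  have "bivectors \<subseteq> J" unfolding bivectors_def by (intro span_minimal sub) (auto intro: all)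
  then show ?thesis using J(1) by blast
qed

end

section \<open>The bivector of a pair of spinors\<close>

context spinor_form
begin

lemma rho_pair_square: "P \<in> pairs \<Longrightarrow> \<rho> (monomial P) (\<rho> (monomial P) \<psi>) = sS (mono_sq P) \<psi>"
  using monomial_square[OF pairsD(1)] by (simp add: rho_scale rho_one flip: rho_mult)

text \<open>The map \<open>L\<close>. In its usual form the summand for \<open>i < j\<close> has the factor \<open>g(x\<^sub>i,x\<^sub>i) g(x\<^sub>j,x\<^sub>j) x\<^sub>j x\<^sub>i\<close>, which is
  the inverse of \<open>x\<^sub>i x\<^sub>j\<close>; here that inverse is \<open>mono_sq P\<close> times \<open>monomial P\<close> for \<open>P = {i, j}\<close>.\<close>

definition spinor_bivector :: "'s \<Rightarrow> 's \<Rightarrow> 'c" where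
  "spinor_bivector \<phi> \<psi> =
    sC (1 / 2) (\<Sum>P\<in>pairs. sC (mono_sq P * B \<phi> (\<rho> (monomial P) \<psi>)) (monomial P))"

lemma spinor_bivector_in: "spinor_bivector \<phi> \<psi> \<in> bivectors"
  unfolding spinor_bivector_def by (intro subspace_scale[OF subspace_bivectors] bivector_sumI)

lemma coef_spinor_bivector:
  "P \<in> pairs \<Longrightarrow> coef (spinor_bivector \<phi> \<psi>) P = mono_sq P * B \<phi> (\<rho> (monomial P) \<psi>) / 2"
  by (simp add: spinor_bivector_def coef_scale coef_pair_sum pairsD)

lemma spinor_bivector_add:
  "spinor_bivector (\<phi> + \<phi>') \<psi> = spinor_bivector \<phi> \<psi> + spinor_bivector \<phi>' \<psi>"
  "spinor_bivector \<phi> (\<psi> + \<psi>') = spinor_bivector \<phi> \<psi> + spinor_bivector \<phi> \<psi>'"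
  by (simp_all add: spinor_bivector_def form_add rho_add_right distrib_left scale_left_distrib
      sum.distrib scale_right_distrib)

lemma spinor_bivector_scale:
  "spinor_bivector (sS a \<phi>) \<psi> = sC a (spinor_bivector \<phi> \<psi>)"
  "spinor_bivector \<phi> (sS a \<psi>) = sC a (spinor_bivector \<phi> \<psi>)"
  by (simp_all add: spinor_bivector_def form_scale rho_scale_right scale_sum_right mult_ac)

lemma rho_bivector: "A \<in> bivectors \<Longrightarrow> \<rho> A \<psi> = (\<Sum>P\<in>pairs. sS (coef A P) (\<rho> (monomial P) \<psi>))"
  by (subst bivector_expansion[of A]) (simp_all add: rho_sum rho_scale)

lemma form_bivector:
  assumes "A \<in> bivectors"
  shows "B (\<rho> A \<phi>) \<psi> = - B \<phi> (\<rho> A \<psi>)"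
proof -
  have "B (\<rho> A \<phi>) \<psi> = (\<Sum>P\<in>pairs. coef A P * B (\<rho> (monomial P) \<phi>) \<psi>)"
    by (simp add: rho_bivector[OF assms] form_sum form_scale)
  also have "\<dots> = (\<Sum>P\<in>pairs. - (coef A P * B \<phi> (\<rho> (monomial P) \<psi>)))"
    by (intro sum.cong) (simp_all add: form_monomial pairsD swap_sign_def)
  also have "\<dots> = - B \<phi> (\<rho> A \<psi>)"
    by (simp add: rho_bivector[OF assms] form_sum form_scale sum_negf)
  finally show ?thesis .
qed

text \<open>This determines the bivector, because the trace form is nondegenerate on bivectors; it is a description of \<open>L\<close> without reference to a basis.\<close>

lemma tr_spinor_bivector:
  assumes "A \<in> bivectors"
  shows "tr (spinor_bivector \<phi> \<psi> * A) = B \<phi> (\<rho> A \<psi>) / 2"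
proof -
  have "tr (spinor_bivector \<phi> \<psi> * A) = (\<Sum>P\<in>pairs. coef A P * tr (spinor_bivector \<phi> \<psi> * monomial P))"
    by (subst bivector_expansion[OF assms]) (simp add: sum_distrib_left tr_sum scale_mult tr_scale)
  also have "\<dots> = (\<Sum>P\<in>pairs. coef A P * B \<phi> (\<rho> (monomial P) \<psi>) / 2)"
  proof (rule sum.cong[OF refl])
    fix P assume P: "P \<in> pairs"
    have "tr (spinor_bivector \<phi> \<psi> * monomial P) = (mono_sq P * mono_sq P) * B \<phi> (\<rho> (monomial P) \<psi>) / 2"
      using P by (simp add: tr_mult_monomial pairsD(1) coef_spinor_bivector)
    then show "coef A P * tr (spinor_bivector \<phi> \<psi> * monomial P) = coef A P * B \<phi> (\<rho> (monomial P) \<psi>) / 2"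
      using P by (simp add: mono_sq_square pairsD(1))
  qed
  also have "\<dots> = B \<phi> (\<rho> A \<psi>) / 2"
    by (simp add: rho_bivector[OF assms] form_sum form_scale sum_divide_distrib)
  finally show ?thesis .
qed

text \<open>Invariance of the trace form moves the commutator from \<open>L\<close> to the test bivector; skewness of \<open>\<rho> A\<close> for \<open>B\<close> does the rest.\<close>

lemma commutator_spinor_bivector:
  assumes A: "A \<in> bivectors"
  shows "commutator A (spinor_bivector \<phi> \<psi>) =
    spinor_bivector (\<rho> A \<phi>) \<psi> + spinor_bivector \<phi> (\<rho> A \<psi>)"
proof (rule coef_eqI)
  fix K assume K: "K \<subseteq> I"
  let ?L = "spinor_bivector \<phi> \<psi>"
  show "coef (commutator A ?L) K = coef (spinor_bivector (\<rho> A \<phi>) \<psi> + spinor_bivector \<phi> (\<rho> A \<psi>)) K"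
  proof (cases "K \<in> pairs")
    case False
    then show ?thesis using K A spinor_bivector_in
      by (simp add: coef_bivector commutator_bivectors coef_add)
  next
    case True
    have "tr (commutator A ?L * monomial K) = tr (?L * commutator (monomial K) A)"
      using tr_commute[of A "?L * monomial K"]
      by (simp add: left_diff_distrib right_diff_distrib tr_diff mult.assoc)
    also have "\<dots> = B \<phi> (\<rho> (commutator (monomial K) A) \<psi>) / 2"
      using True A by (intro tr_spinor_bivector commutator_bivectors monomial_in_bivectors)
    also have "\<dots> = (B (\<rho> A \<phi>) (\<rho> (monomial K) \<psi>) + B \<phi> (\<rho> (monomial K) (\<rho> A \<psi>))) / 2"
      by (simp add: rho_diff rho_mult form_diff form_bivector[OF A])
    finally show ?thesis using True K
      by (simp add: coef_eq_tr[OF K, of "commutator A ?L"] coef_add coef_spinor_bivector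
          add_divide_distrib distrib_left)
  qed
qed

end

section \<open>Half-spinors\<close>

locale half_spinors = spinor_form sC y \<eta> I sS \<rho> B
  for sC :: "'k::field \<Rightarrow> 'c::ring_1 \<Rightarrow> 'c" and y \<eta> I
    and sS :: "'k \<Rightarrow> 's::ab_group_add \<Rightarrow> 's" and \<rho> B +
  fixes S1 S2 :: "'s set"
  assumes subspace_S1: "S.subspace S1" and subspace_S2: "S.subspace S2"
    and disjoint: "S1 \<inter> S2 = {0}"
    and decomposition: "\<exists>\<phi>\<in>S1. \<exists>\<psi>\<in>S2. \<chi> = \<phi> + \<psi>"
    and gen_S1: "i \<in> I \<Longrightarrow> \<phi> \<in> S1 \<Longrightarrow> \<rho> (y i) \<phi> \<in> S2"
    and gen_S2: "i \<in> I \<Longrightarrow> \<phi> \<in> S2 \<Longrightarrow> \<rho> (y i) \<phi> \<in> S1"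
begin

lemma monomial_half:
  assumes "K \<subseteq> I"
  shows "\<phi> \<in> S1 \<Longrightarrow> \<rho> (monomial K) \<phi> \<in> (if even (card K) then S1 else S2)"
    and "\<phi> \<in> S2 \<Longrightarrow> \<rho> (monomial K) \<phi> \<in> (if even (card K) then S2 else S1)"
proof -
  have "(\<forall>\<phi>\<in>S1. \<rho> (monomial K) \<phi> \<in> (if even (card K) then S1 else S2)) \<and>
    (\<forall>\<phi>\<in>S2. \<rho> (monomial K) \<phi> \<in> (if even (card K) then S2 else S1))"
    using assms
  proof (induction rule: index_set_induct)
    case (insert b K)
    then show ?case using gen_S1 gen_S2 by (auto simp: monomial_insert_min rho_mult split: if_splits)
  qed (simp add: rho_one)
  then show "\<phi> \<in> S1 \<Longrightarrow> \<rho> (monomial K) \<phi> \<in> (if even (card K) then S1 else S2)"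
    and "\<phi> \<in> S2 \<Longrightarrow> \<rho> (monomial K) \<phi> \<in> (if even (card K) then S2 else S1)"
    by blast+
qed

lemma bivector_S1:
  assumes "A \<in> bivectors" "\<phi> \<in> S1"
  shows "\<rho> A \<phi> \<in> S1"
  unfolding rho_bivector[OF assms(1)]
proof (intro S.subspace_sum[OF subspace_S1] S.subspace_scale[OF subspace_S1])
  fix P assume "P \<in> pairs"
  then show "\<rho> (monomial P) \<phi> \<in> S1" using monomial_half(1)[of P \<phi>] assms(2) by (simp add: pairsD)
qed

lemma decomposition_unique:
  assumes "\<phi> + \<psi> = \<phi>' + \<psi>'" "\<phi> \<in> S1" "\<phi>' \<in> S1" "\<psi> \<in> S2" "\<psi>' \<in> S2"
  shows "\<phi> = \<phi>'" "\<psi> = \<psi>'"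
proof -
  have eq: "\<phi> - \<phi>' = \<psi>' - \<psi>" using assms(1) by (simp add: algebra_simps)
  have "\<phi> - \<phi>' \<in> S1" "\<psi>' - \<psi> \<in> S2"
    using assms subspace_S1 subspace_S2 by (simp_all add: S.subspace_diff)
  then have "\<phi> - \<phi>' \<in> S1 \<inter> S2" unfolding eq by blast
  then have "\<phi> - \<phi>' = 0" unfolding disjoint by simp
  then show "\<phi> = \<phi>'" "\<psi> = \<psi>'" using eq by simp_all
qed

text \<open>Every linear endomorphism of \<open>S\<close> comes from \<open>C\<close>, in particular the one that is \<open>1\<close> on \<open>S1\<close> and \<open>-1\<close> on \<open>S2\<close>.\<close>

lemma chirality_exists:
  "\<exists>q. (\<forall>\<phi>\<in>S1. \<rho> q \<phi> = \<phi>) \<and> (\<forall>\<psi>\<in>S2. \<rho> q \<psi> = - \<psi>)"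
proof -
  obtain p r where pr: "\<And>\<chi>. p \<chi> \<in> S1" "\<And>\<chi>. r \<chi> \<in> S2" "\<And>\<chi>. \<chi> = p \<chi> + r \<chi>"
    using decomposition by metis
  have add: "p (\<chi> + \<chi>') = p \<chi> + p \<chi>'" "r (\<chi> + \<chi>') = r \<chi> + r \<chi>'" for \<chi> \<chi>'
  proof -
    have "p (\<chi> + \<chi>') + r (\<chi> + \<chi>') = (p \<chi> + p \<chi>') + (r \<chi> + r \<chi>')"
      using pr(3)[of "\<chi> + \<chi>'"] pr(3)[of \<chi>] pr(3)[of \<chi>'] by (metis add.assoc add.left_commute)
    from decomposition_unique[OF this] show "p (\<chi> + \<chi>') = p \<chi> + p \<chi>'" "r (\<chi> + \<chi>') = r \<chi> + r \<chi>'"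
      using pr(1,2) S.subspace_add subspace_S1 subspace_S2 by simp_all
  qed
  have scale: "p (sS a \<chi>) = sS a (p \<chi>)" "r (sS a \<chi>) = sS a (r \<chi>)" for a \<chi>
  proof -
    have "p (sS a \<chi>) + r (sS a \<chi>) = sS a (p \<chi>) + sS a (r \<chi>)"
      using pr(3)[of "sS a \<chi>"] pr(3)[of \<chi>] by (metis S.scale_right_distrib)
    from decomposition_unique[OF this] show "p (sS a \<chi>) = sS a (p \<chi>)" "r (sS a \<chi>) = sS a (r \<chi>)"
      using pr(1,2) S.subspace_scale subspace_S1 subspace_S2 by simp_all
  qed
  have "Vector_Spaces.linear sS sS (\<lambda>\<chi>. p \<chi> - r \<chi>)"
    using add scale S.vector_space_axioms by (simp add: Vector_Spaces.linear_iff S.scale_right_diff_distrib)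
  then obtain q where q: "\<rho> q = (\<lambda>\<chi>. p \<chi> - r \<chi>)" using rho_surject by blast
  have "p \<phi> = \<phi> \<and> r \<phi> = 0" if "\<phi> \<in> S1" for \<phi>
  proof -
    have "p \<phi> + r \<phi> = \<phi> + 0" using pr(3)[of \<phi>] by simp
    from decomposition_unique[OF this pr(1) that pr(2) S.subspace_0[OF subspace_S2]] show ?thesis by simp
  qed
  moreover have "p \<psi> = 0 \<and> r \<psi> = \<psi>" if "\<psi> \<in> S2" for \<psi>
  proof -
    have "p \<psi> + r \<psi> = 0 + \<psi>" using pr(3)[of \<psi>] by simp
    from decomposition_unique[OF this pr(1) S.subspace_0[OF subspace_S1] pr(2) that] show ?thesis by simp
  qed
  ultimately show ?thesis by (intro exI[of _ q]) (simp add: q)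
qed

text \<open>The chirality operator anticommutes with the generators, which exchange the half-spinor spaces; hence it is a multiple of the product of all generators. The constant is normalised by \<open>q * q = 1\<close>.\<close>

lemma top_monomial_half:
  "\<exists>c. c * c = mono_sq I \<and> (\<forall>\<phi>\<in>S1. \<rho> (monomial I) \<phi> = sS c \<phi>) \<and>
    (\<forall>\<psi>\<in>S2. \<rho> (monomial I) \<psi> = sS (- c) \<psi>)"
proof -
  obtain q where q1: "\<And>\<phi>. \<phi> \<in> S1 \<Longrightarrow> \<rho> q \<phi> = \<phi>" and q2: "\<And>\<psi>. \<psi> \<in> S2 \<Longrightarrow> \<rho> q \<psi> = - \<psi>"
    using chirality_exists by blast
  have "y j * q = - (q * y j)" if j: "j \<in> I" for j
  proof (rule rho_inject, rule ext)
    fix \<chi>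
    obtain \<phi> \<psi> where "\<phi> \<in> S1" "\<psi> \<in> S2" "\<chi> = \<phi> + \<psi>" using decomposition by blast
    then show "\<rho> (y j * q) \<chi> = \<rho> (- (q * y j)) \<chi>"
      using gen_S1[OF j] gen_S2[OF j]
      by (simp add: rho_mult rho_minus rho_add_right rho_minus_right q1 q2)
  qed
  then have q: "q = sC (coef q I) (monomial I)" by (rule anticommuting_top)
  have qq: "q * q = 1"
  proof (rule rho_inject, rule ext)
    fix \<chi>
    obtain \<phi> \<psi> where "\<phi> \<in> S1" "\<psi> \<in> S2" "\<chi> = \<phi> + \<psi>" using decomposition by blast
    then show "\<rho> (q * q) \<chi> = \<rho> 1 \<chi>"
      by (simp add: rho_mult rho_minus rho_add_right rho_minus_right rho_one q1 q2)
  qed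
  define a where "a = coef q I"
  have "1 = sC a (monomial I) * sC a (monomial I)" using q qq by (simp add: a_def)
  also have "\<dots> = sC (a * a * mono_sq I) 1"
    by (simp add: scale_mult monomial_square mult.assoc)
  finally have "tr 1 = tr (sC (a * a * mono_sq I) 1)" by simp
  then have a: "a * a * mono_sq I = 1" by (simp add: tr_scale tr_one)
  define c where "c = a * mono_sq I"
  have mI: "mono_sq I * mono_sq I = 1" by (rule mono_sq_square) simp
  have "c * a = 1" using a by (simp add: c_def mult_ac)
  then have top: "monomial I = sC c q" using q by (metis a_def scale_one scale_scale)
  have "c * c = (a * a * mono_sq I) * mono_sq I" by (simp add: c_def mult_ac)
  then have "c * c = mono_sq I" using a by simp
  then show ?thesis by (intro exI[of _ c]) (simp add: top rho_scale q1 q2)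
qed

text \<open>The hypothesis on the reversal sign makes the product of all generators self-adjoint for \<open>B\<close>, and the half-spinor spaces are eigenspaces of it for different eigenvalues.\<close>

lemma half_spinors_orthogonal:
  assumes "swap_sign (card I) = (1::'k)" "\<phi> \<in> S1" "\<psi> \<in> S2"
  shows "B \<phi> \<psi> = 0" "B \<psi> \<phi> = 0"
proof -
  obtain c where c: "c * c = mono_sq I" "\<And>\<phi>. \<phi> \<in> S1 \<Longrightarrow> \<rho> (monomial I) \<phi> = sS c \<phi>"
      "\<And>\<psi>. \<psi> \<in> S2 \<Longrightarrow> \<rho> (monomial I) \<psi> = sS (- c) \<psi>"
    using top_monomial_half by blast
  have "c \<noteq> 0" using c(1) mono_sq_square[of I] by auto
  have "B (\<rho> (monomial I) \<alpha>) \<beta> = B \<alpha> (\<rho> (monomial I) \<beta>)" for \<alpha> \<beta>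
    using form_monomial[of I] assms(1) by simp
  from this[of \<phi> \<psi>] this[of \<psi> \<phi>] have "2 * c * B \<phi> \<psi> = 0" "2 * c * B \<psi> \<phi> = 0"
    using assms by (simp_all add: c form_scale form_minus)
  then show "B \<phi> \<psi> = 0" "B \<psi> \<phi> = 0" using \<open>c \<noteq> 0\<close> two_nonzero by simp_all
qed

end

section \<open>Sixteen dimensions: symmetry of the spinor norm and the cyclic identity\<close>

lemma sum_Pow_insert_card:
  assumes "finite I" "x \<notin> I"
  shows "(\<Sum>K\<in>Pow (insert x I). f (card K)) =
    (\<Sum>K\<in>Pow I. f (card K) + f (Suc (card K)) :: 'a::comm_monoid_add)"
proof -
  have inj: "inj_on (insert x) (Pow I)" using assms(2) by (auto simp: inj_on_def)
  have "(\<Sum>K\<in>Pow (insert x I). f (card K)) =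
      (\<Sum>K\<in>Pow I. f (card K)) + (\<Sum>K\<in>insert x ` Pow I. f (card K))"
    unfolding Pow_insert using assms by (intro sum.union_disjoint) auto
  also have "(\<Sum>K\<in>insert x ` Pow I. f (card K)) = (\<Sum>K\<in>Pow I. f (Suc (card K)))"
    unfolding sum.reindex[OF inj] comp_def
  proof (rule sum.cong[OF refl])
    fix K assume "K \<in> Pow I"
    then have "finite K" "x \<notin> K" using assms finite_subset by auto
    then show "f (card (insert x K)) = f (Suc (card K))" by simp
  qed
  finally show ?thesis by (simp add: sum.distrib)
qed

text \<open>Each new element of \<open>I\<close> applies the operator \<open>T f k = f k + f (k + 1)\<close> to the summand. The reversal sign
  satisfies \<open>f (k + 2) = - f k\<close>, so that \<open>T\<^sup>2 f k = 2 f (k + 1)\<close> and \<open>T\<^sup>4 f = - 4 f\<close>.\<close>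

lemma sum_swap_sign:
  assumes "finite I" "card I = 4 * m"
  shows "(\<Sum>K\<in>Pow I. swap_sign (card K)) = ((- 4) ^ m :: 'a::comm_ring_1)"
proof -
  define T where "T = (\<lambda>(f :: nat \<Rightarrow> 'a) k. f k + f (Suc k))"
  have pow: "(\<Sum>K\<in>Pow J. f (card K)) = (T ^^ card J) f 0" if "finite J" for J :: "'b set" and f
    using that
  proof (induction J arbitrary: f)
    case (insert x J)
    have "(\<Sum>K\<in>Pow (insert x J). f (card K)) = (\<Sum>K\<in>Pow J. T f (card K))"
      using insert by (simp add: sum_Pow_insert_card T_def)
    then show ?case using insert by (simp add: funpow_swap1)
  qed simp
  have "(T ^^ (4 * m)) swap_sign = (\<lambda>k. (- 4) ^ m * swap_sign k)" for m
  proof (induction m)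
    case (Suc m)
    have sign: "swap_sign (Suc (Suc k)) = - (swap_sign k :: 'a)" for k
      by (simp add: swap_sign_Suc mult.assoc[symmetric] flip: power_add)
    have "(T ^^ (4 * Suc m)) swap_sign = T (T (T (T ((T ^^ (4 * m)) swap_sign))))"
      by (simp add: numeral_eq_Suc)
    also have "\<dots> = T (T (T (T (\<lambda>k. (- 4) ^ m * swap_sign k))))"
      by (simp only: Suc.IH)
    also have "\<dots> = (\<lambda>k. (- 4) ^ Suc m * swap_sign k)"
      by (simp add: T_def sign fun_eq_iff algebra_simps)
    finally show ?case .
  qed simp
  then show ?thesis using pow[OF assms(1), of swap_sign] assms(2) by (simp add: swap_sign_def numeral_2_eq_2)
qed

locale e8_spinors = half_spinors sC y \<eta> I sS \<rho> B S1 S2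
  for sC :: "'k::field \<Rightarrow> 'c::ring_1 \<Rightarrow> 'c" and y \<eta> I
    and sS :: "'k \<Rightarrow> 's::ab_group_add \<Rightarrow> 's" and \<rho> B S1 S2 +
  assumes card_I: "card I = 16" and dim_S: "S.dim UNIV = 256"
begin

lemma dim_S_nonzero: "(256::'k) \<noteq> 0"
  using dim_nonzero by (simp add: dim_S)

lemma form_symmetric: "B \<phi> \<psi> = B \<psi> \<phi>"
proof -
  have "(\<Sum>K\<in>Pow I. swap_sign (card K)) = (256 :: 'k)"
    using sum_swap_sign[OF finite_I, of 4] by (simp add: card_I)
  then show ?thesis using form_swap[of \<phi> \<psi>] dim_S_nonzero by (simp add: dim_S)
qed

lemma orthogonal: "\<phi> \<in> S1 \<Longrightarrow> \<psi> \<in> S2 \<Longrightarrow> B \<phi> \<psi> = 0" "\<phi> \<in> S1 \<Longrightarrow> \<psi> \<in> S2 \<Longrightarrow> B \<psi> \<phi> = 0"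
  using half_spinors_orthogonal by (simp_all add: card_I swap_sign_mod4)

lemma spinor_bivector_antisym: "spinor_bivector \<phi> \<psi> = - spinor_bivector \<psi> \<phi>"
proof -
  have "mono_sq P * B \<phi> (\<rho> (monomial P) \<psi>) = - (mono_sq P * B \<psi> (\<rho> (monomial P) \<phi>))"
    if P: "P \<in> pairs" for P
    using form_monomial[OF pairsD(1)[OF P], of \<psi> \<phi>] form_symmetric[of \<phi> "\<rho> (monomial P) \<psi>"] pairsD(2)[OF P]
    by (simp add: swap_sign_mod4)
  then show ?thesis
    by (simp add: spinor_bivector_def sum_negf)
qed

text \<open>The case of the Jacobi identity that depends on the dimension. With \<open>D\<close> the antisymmetrised rank-one operator
  and \<open>Q\<close> its sandwich, \<open>\<rho> Q \<chi>\<close> is twice the sum of the last two cyclic terms, by antisymmetry of \<open>L\<close>. Expanding \<open>D\<close>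
  in monomials instead, the coefficient at \<open>K\<close> vanishes for odd \<open>card K\<close> by orthogonality of the half-spinor
  spaces and for \<open>card K\<close> divisible by \<open>4\<close> by symmetry of \<open>B\<close>; the sandwich eigenvalue \<open>s\<close> vanishes for
  cardinality \<open>6\<close> and \<open>10\<close>. The cardinalities \<open>2\<close> and \<open>14\<close> contribute equally, and together they give minus
  twice the first cyclic term.\<close>

lemma spinor_jacobi:
  assumes "\<phi> \<in> S1" "\<psi> \<in> S1" "\<chi> \<in> S1"
  shows "\<rho> (spinor_bivector \<phi> \<psi>) \<chi> + \<rho> (spinor_bivector \<psi> \<chi>) \<phi> + \<rho> (spinor_bivector \<chi> \<phi>) \<psi> = 0"
proof -
  define D where "D = rank_one \<phi> (B \<psi>) - rank_one \<psi> (B \<phi>)"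
  define b where "b = (\<lambda>K. mono_sq K * B \<psi> (\<rho> (monomial K) \<phi>))"
  define s where "s = (\<lambda>k::nat. 120 - 2 * of_nat (k * (16 - k)) :: 'k)"
  \<comment> \<open>doubling removes the factor one half of \<open>spinor_bivector\<close>\<close>
  have two: "sS 2 (\<rho> (spinor_bivector \<alpha> \<beta>) \<gamma>) =
      (\<Sum>P\<in>pairs. sS (mono_sq P * B \<alpha> (\<rho> (monomial P) \<beta>)) (\<rho> (monomial P) \<gamma>))" for \<alpha> \<beta> \<gamma>
    using two_nonzero by (simp add: spinor_bivector_def rho_scale rho_sum)
  have coef_D: "coef D K = (1 - swap_sign (card K)) * b K / 256" if K: "K \<subseteq> I" for K
  proof -
    have "B \<phi> (\<rho> (monomial K) \<psi>) = swap_sign (card K) * B \<psi> (\<rho> (monomial K) \<phi>)"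
      using form_monomial[OF K, of \<psi> \<phi>] form_symmetric[of \<phi> "\<rho> (monomial K) \<psi>"] by simp
    then show ?thesis
      using coef_add[OF K, of "rank_one \<phi> (B \<psi>)" "- rank_one \<psi> (B \<phi>)"]
      by (simp add: D_def b_def coef_minus[OF K] coef_rank_one[OF functional_form(1) K] dim_S
          algebra_simps diff_divide_distrib)
  qed
  have b_odd: "b K = 0" if "K \<subseteq> I" "odd (card K)" for K
    using monomial_half(1)[OF that(1) assms(1)] that orthogonal(1)[OF assms(2)] by (simp add: b_def)
  have binom: "(of_nat (16 choose 2) :: 'k) = 120"
    by (simp add: numeral_eq_Suc del: One_nat_def)
  \<comment> \<open>the sandwiched operator, computed in two ways\<close>
  define Q where "Q = (\<Sum>P\<in>pairs. sC (mono_sq P) (monomial P * D * monomial P))"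
  have "\<rho> Q \<chi> = sS 2 (\<rho> (spinor_bivector \<psi> \<chi>) \<phi>) - sS 2 (\<rho> (spinor_bivector \<phi> \<chi>) \<psi>)"
    unfolding two sum_subtractf[symmetric]
    by (simp add: Q_def D_def rho_sum rho_scale rho_mult rho_diff rho_rank_one functional_form(1)
        rho_scale_right rho_diff_right S.scale_right_diff_distrib functional_add)
  also have "\<dots> = sS 2 (\<rho> (spinor_bivector \<psi> \<chi>) \<phi> + \<rho> (spinor_bivector \<chi> \<phi>) \<psi>)"
    by (subst spinor_bivector_antisym[of \<phi> \<chi>]) (simp add: rho_minus S.scale_right_distrib)
  finally have Q1: "\<rho> Q \<chi> = sS 2 (\<rho> (spinor_bivector \<psi> \<chi>) \<phi> + \<rho> (spinor_bivector \<chi> \<phi>) \<psi>)" .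

  have "Q = (\<Sum>P\<in>pairs. \<Sum>K\<in>Pow I. sC (coef D K) (sC (mono_sq P) (monomial P * monomial K * monomial P)))"
    unfolding Q_def
    by (subst monomial_expansion[of D])
       (simp add: sum_distrib_left sum_distrib_right scale_sum_right scale_mult mult.assoc mult.commute)
  also have "\<dots> = (\<Sum>K\<in>Pow I. sC (coef D K) (\<Sum>P\<in>pairs. sC (mono_sq P) (monomial P * monomial K * monomial P)))"
    by (subst sum.swap) (simp add: scale_sum_right)
  also have "\<dots> = (\<Sum>K\<in>Pow I. sC (coef D K) (sC (s (card K)) (monomial K)))"
    by (intro sum.cong) (simp_all add: sandwich_monomial card_I s_def binom del: of_nat_mult)
  finally have "\<rho> Q \<chi> = (\<Sum>K\<in>Pow I. sS (coef D K * s (card K)) (\<rho> (monomial K) \<chi>))"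
    by (simp add: rho_sum rho_scale)
  also have "\<dots> = (\<Sum>K\<in>pairs \<union> (\<lambda>P. I - P) ` pairs. sS (coef D K * s (card K)) (\<rho> (monomial K) \<chi>))"
  proof (rule sum.mono_neutral_right)
    show "\<forall>K\<in>Pow I - (pairs \<union> (\<lambda>P. I - P) ` pairs). sS (coef D K * s (card K)) (\<rho> (monomial K) \<chi>) = 0"
    proof
      fix K assume K: "K \<in> Pow I - (pairs \<union> (\<lambda>P. I - P) ` pairs)"
      then have KI: "K \<subseteq> I" by simp
      have "card K \<noteq> 2" using K by (auto simp: pairs_def)
      moreover have "card K \<noteq> 14"
      proof
        assume "card K = 14"
        then have "I - K \<in> pairs" using KI card_Diff_subset[OF finite_index[OF KI] KI] card_I
          by (simp add: pairs_def)
        moreover have "K = I - (I - K)" using KI by blast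
        ultimately show False using K by blast
      qed
      moreover have "card K \<le> 16" using card_mono[OF finite_I KI] card_I by simp
      ultimately have "odd (card K) \<or> card K mod 4 = 0 \<or> card K = 6 \<or> card K = 10" by presburger
      then have "coef D K * s (card K) = 0"
      proof (elim disjE)
        assume "odd (card K)"
        then show ?thesis using b_odd[OF KI] coef_D[OF KI] by simp
      next
        assume "card K mod 4 = 0"
        then show ?thesis using coef_D[OF KI] by (simp add: swap_sign_mod4)
      qed (simp_all add: s_def)
      then show "sS (coef D K * s (card K)) (\<rho> (monomial K) \<chi>) = 0" by simp
    qed
  qed (auto simp: pairsD dest: pairsD)
  also have "\<dots> = (\<Sum>P\<in>pairs. sS (coef D P * s (card P)) (\<rho> (monomial P) \<chi>)) +
      (\<Sum>P\<in>pairs. sS (coef D (I - P) * s (card (I - P))) (\<rho> (monomial (I - P)) \<chi>))"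
  proof -
    have inj: "inj_on (\<lambda>P. I - P) pairs"
      by (rule inj_onI) (metis double_diff pairsD(1) subset_refl)
    have card: "card (I - P) = 14" if "P \<in> pairs" for P
      using card_Diff_subset[of P I] that card_I by (simp add: pairsD)
    then have "pairs \<inter> (\<lambda>P. I - P) ` pairs = {}" by (force simp: pairs_def)
    then show ?thesis using inj by (simp add: sum.union_disjoint sum.reindex)
  qed
  also have "(\<Sum>P\<in>pairs. sS (coef D (I - P) * s (card (I - P))) (\<rho> (monomial (I - P)) \<chi>)) =
      (\<Sum>P\<in>pairs. sS (coef D P * s (card P)) (\<rho> (monomial P) \<chi>))"
  proof (rule sum.cong[OF refl])
    fix P assume P: "P \<in> pairs"
    then have PI: "P \<subseteq> I" "card P = 2" by (simp_all add: pairsD)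
    obtain c where c: "c * c = mono_sq I" "\<And>\<phi>. \<phi> \<in> S1 \<Longrightarrow> \<rho> (monomial I) \<phi> = sS c \<phi>"
      using top_monomial_half by blast
    obtain r where r: "r * r = 1" "monomial P * monomial I = sC r (monomial (sym_diff P I))"
      using monomial_mult[OF PI(1), of I] by blast
    have "sym_diff P I = I - P" using PI(1) by blast
    then have compl: "monomial (I - P) = sC r (monomial P * monomial I)" using r by simp
    have card: "card (I - P) = 14" using card_Diff_subset[of P I] P card_I by (simp add: pairsD)
    have act: "\<rho> (monomial (I - P)) \<gamma> = sS (r * c) (\<rho> (monomial P) \<gamma>)" if "\<gamma> \<in> S1" for \<gamma>
      using that by (simp add: compl rho_scale rho_mult c rho_scale_right)
    \<comment> \<open>on half-spinors \<open>monomial (I - P)\<close> is \<open>r * c\<close> times \<open>monomial P\<close>; this scalar enters the summand twice and \<open>mono_sq I = c * c\<close> enters once more, and these factors cancel\<close>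
    have sq: "mono_sq (I - P) = mono_sq P * mono_sq I"
    proof -
      have "monomial (I - P) * monomial (I - P) =
          sC (r * r) (monomial P * (monomial I * monomial P) * monomial I)"
        by (simp add: compl scale_mult mult.assoc)
      also have "monomial I * monomial P = monomial P * monomial I"
        using pairs_commute[OF P, of I] PI by (simp add: Int_absorb2)
      also have "sC (r * r) (monomial P * (monomial P * monomial I) * monomial I) =
          sC (mono_sq I) (monomial P * monomial P)"
        by (simp add: r(1) mult.assoc monomial_square scale_mult)
      also have "\<dots> = sC (mono_sq P * mono_sq I) 1"
        by (simp add: monomial_square PI mult.commute)
      finally have "tr (sC (mono_sq (I - P)) 1) = tr (sC (mono_sq P * mono_sq I) 1)"
        by (simp add: monomial_square)
      then show ?thesis by (simp add: tr_scale tr_one)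
    qed
    have "b (I - P) * (r * c) = (r * r) * (c * c * mono_sq I) * b P"
      by (simp add: b_def sq act[OF assms(1)] form_scale mult_ac)
    then have bc: "b (I - P) * (r * c) = b P" using r c mono_sq_square[of I] by simp
    have "coef D (I - P) * s (card (I - P)) * (r * c) = coef D P * s (card P)"
      by (simp add: coef_D PI card s_def swap_sign_mod4 bc[symmetric])
    then show "sS (coef D (I - P) * s (card (I - P))) (\<rho> (monomial (I - P)) \<chi>) =
        sS (coef D P * s (card P)) (\<rho> (monomial P) \<chi>)"
      by (simp add: act[OF assms(3)] del: mult.assoc)
  qed
  also have "(\<Sum>P\<in>pairs. sS (coef D P * s (card P)) (\<rho> (monomial P) \<chi>)) +
      (\<Sum>P\<in>pairs. sS (coef D P * s (card P)) (\<rho> (monomial P) \<chi>)) =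
      (\<Sum>P\<in>pairs. sS (b P) (\<rho> (monomial P) \<chi>))"
  proof -
    have "coef D P * s (card P) + coef D P * s (card P) = b P" if "P \<in> pairs" for P
    proof -
      define u where "u = b P / 256"
      have "coef D P = 2 * u" "s (card P) = 64"
        using pairsD[OF that] by (simp_all add: coef_D s_def swap_sign_mod4 u_def)
      then have "coef D P * s (card P) + coef D P * s (card P) = 256 * u" by simp
      also have "\<dots> = b P" using dim_S_nonzero by (simp add: u_def)
      finally show ?thesis .
    qed
    then show ?thesis by (simp add: S.scale_left_distrib[symmetric] flip: sum.distrib)
  qed
  also have "\<dots> = sS 2 (\<rho> (spinor_bivector \<psi> \<phi>) \<chi>)" unfolding two b_def ..
  also have "\<dots> = sS 2 (- \<rho> (spinor_bivector \<phi> \<psi>) \<chi>)"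
    by (subst spinor_bivector_antisym) (simp add: rho_minus)
  finally have "sS 2 (\<rho> (spinor_bivector \<psi> \<chi>) \<phi> + \<rho> (spinor_bivector \<chi> \<phi>) \<psi>) =
      sS 2 (- \<rho> (spinor_bivector \<phi> \<psi>) \<chi>)" using Q1 by simp
  then have "\<rho> (spinor_bivector \<psi> \<chi>) \<phi> + \<rho> (spinor_bivector \<chi> \<phi>) \<psi> = - \<rho> (spinor_bivector \<phi> \<psi>) \<chi>"
    using two_nonzero by (rule S.scale_left_imp_eq[rotated])
  then show ?thesis by (simp add: add.assoc)
qed

end

section \<open>The Lie bracket and its ideals\<close>

text \<open>Characteristic different from \<open>3\<close> separates bivectors from spinors in an ideal; nondegeneracy makes brackets of spinors nonzero.\<close>

locale e8_bracket = e8_spinors sC y \<eta> I sS \<rho> B S1 S2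
  for sC :: "'k::field \<Rightarrow> 'c::ring_1 \<Rightarrow> 'c" and y \<eta> I
    and sS :: "'k \<Rightarrow> 's::ab_group_add \<Rightarrow> 's" and \<rho> B S1 S2 +
  assumes three_nonzero: "(3::'k) \<noteq> 0"
    and form_nondegenerate: "(\<And>\<psi>. B \<psi> \<phi> = 0) \<Longrightarrow> \<phi> = 0"
begin

definition bracket :: "'c \<times> 's \<Rightarrow> 'c \<times> 's \<Rightarrow> 'c \<times> 's" where
  "bracket u v = (commutator (fst u) (fst v) + spinor_bivector (snd u) (snd v),
    \<rho> (fst u) (snd v) - \<rho> (fst v) (snd u))"

abbreviation E where "E \<equiv> bivectors \<times> S1"

lemma bracket_pair:
  "bracket (A, \<phi>) (A', \<phi>') = (commutator A A' + spinor_bivector \<phi> \<phi>', \<rho> A \<phi>' - \<rho> A' \<phi>)"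
  by (simp add: bracket_def)

lemma spinor_bivector_zero: "spinor_bivector 0 \<psi> = 0" "spinor_bivector \<psi> 0 = 0"
  using spinor_bivector_scale(1)[of 0 0 \<psi>] spinor_bivector_scale(2)[of \<psi> 0 0] by simp_all

lemma spinor_bivector_minus: "spinor_bivector \<phi> (- \<psi>) = - spinor_bivector \<phi> \<psi>"
  using spinor_bivector_scale(2)[of \<phi> "-1" \<psi>] by simp

lemma spinor_bivector_diff:
  "spinor_bivector \<phi> (\<psi> - \<psi>') = spinor_bivector \<phi> \<psi> - spinor_bivector \<phi> \<psi>'"
  using spinor_bivector_add(2)[of \<phi> \<psi> "- \<psi>'"] by (simp add: spinor_bivector_minus)

lemma zero_in: "0 \<in> bivectors" "0 \<in> S1"
  using subspace_0[OF subspace_bivectors] S.subspace_0[OF subspace_S1] by auto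

lemma bracket_in: "u \<in> E \<Longrightarrow> v \<in> E \<Longrightarrow> bracket u v \<in> E"
  by (auto simp: bracket_def bivector_S1 subspace_add[OF subspace_bivectors] commutator_bivectors
      spinor_bivector_in S.subspace_diff[OF subspace_S1])

lemma bracket_antisym: "bracket u v = - bracket v u"
  using spinor_bivector_antisym[of "snd u" "snd v"] by (simp add: bracket_def)

lemma spinor_bivector_self: "spinor_bivector \<phi> \<phi> = 0"
proof -
  have "sC 2 (spinor_bivector \<phi> \<phi>) = spinor_bivector \<phi> \<phi> + spinor_bivector \<phi> \<phi>"
    by (metis one_add_one scale_left_distrib scale_one)
  also have "\<dots> = 0" using spinor_bivector_antisym[of \<phi> \<phi>] by (metis add.right_inverse)
  finally show ?thesis using two_nonzero by simp
qed

lemma bracket_self: "bracket u u = 0"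
  by (simp add: bracket_def spinor_bivector_self zero_prod_def)

text \<open>After rewriting products \<open>A * L\<close> by equivariance, all terms of the bivector component cancel in pairs, and
  those of the spinor component cancel up to the cyclic sum of \<open>spinor_jacobi\<close>.\<close>

lemma bracket_jacobi:
  assumes "u \<in> E" "v \<in> E" "w \<in> E"
  shows "bracket u (bracket v w) + bracket v (bracket w u) + bracket w (bracket u v) = 0"
proof -
  obtain A \<phi> A' \<phi>' A'' \<phi>'' where uvw: "u = (A, \<phi>)" "v = (A', \<phi>')" "w = (A'', \<phi>'')"
    by (metis surj_pair)
  have mem: "A \<in> bivectors" "A' \<in> bivectors" "A'' \<in> bivectors" "\<phi> \<in> S1" "\<phi>' \<in> S1" "\<phi>'' \<in> S1"
    using assms uvw by auto
  have der: "A * spinor_bivector \<alpha> \<beta> = spinor_bivector \<alpha> \<beta> * A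
      + spinor_bivector \<alpha> (\<rho> A \<beta>) - spinor_bivector \<beta> (\<rho> A \<alpha>)" if "A \<in> bivectors" for A \<alpha> \<beta>
    using commutator_spinor_bivector[OF that, of \<alpha> \<beta>] spinor_bivector_antisym[of "\<rho> A \<alpha>" \<beta>]
    by (simp add: algebra_simps)
  have cyclic: "- \<rho> (spinor_bivector \<phi>' \<phi>'') \<phi> =
      \<rho> (spinor_bivector \<phi>'' \<phi>) \<phi>' + \<rho> (spinor_bivector \<phi> \<phi>') \<phi>''"
    using spinor_jacobi[OF mem(4,5,6)] by (simp add: neg_eq_iff_add_eq_0 add_ac)
  show ?thesis
    using cyclic
    by (simp add: uvw bracket_pair zero_prod_def der mem distrib_left distrib_right
        left_diff_distrib right_diff_distrib mult.assoc spinor_bivector_diff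
        rho_diff rho_add rho_mult rho_diff_right)
qed

lemma pairs_nonempty: "\<exists>P. P \<in> pairs"
proof -
  obtain P where "P \<subseteq> I" "card P = 2" using obtain_subset_with_card_n[of 2 I] card_I by auto
  then show ?thesis by (auto simp: pairs_def)
qed

lemma spinor_bivector_nonzero:
  assumes "\<phi> \<in> S1" "\<phi> \<noteq> 0"
  shows "\<exists>\<psi>\<in>S1. spinor_bivector \<psi> \<phi> \<noteq> 0"
proof -
  obtain P where P: "P \<in> pairs" using pairs_nonempty by blast
  define \<chi> where "\<chi> = \<rho> (monomial P) \<phi>"
  have mP: "mono_sq P \<noteq> 0" using mono_sq_square[OF pairsD(1)[OF P]] by auto
  have "\<chi> \<noteq> 0"
  proof
    assume "\<chi> = 0"
    then have "sS (mono_sq P) \<phi> = 0" using rho_pair_square[OF P, of \<phi>] by (simp add: \<chi>_def rho_zero_right)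
    then show False using mP assms(2) by simp
  qed
  then obtain \<psi> where \<psi>: "B \<psi> \<chi> \<noteq> 0" using form_nondegenerate by blast
  obtain \<psi>1 \<psi>2 where d: "\<psi>1 \<in> S1" "\<psi>2 \<in> S2" "\<psi> = \<psi>1 + \<psi>2" using decomposition by blast
  have "\<chi> \<in> S1" unfolding \<chi>_def using bivector_S1 monomial_in_bivectors[OF P] assms(1) by blast
  then have "B \<psi>1 \<chi> \<noteq> 0" using \<psi> d orthogonal(2)[of \<chi> \<psi>2] by (simp add: form_add)
  then have "coef (spinor_bivector \<psi>1 \<phi>) P \<noteq> 0"
    using mP two_nonzero by (simp add: coef_spinor_bivector[OF P] \<chi>_def)
  then have "spinor_bivector \<psi>1 \<phi> \<noteq> 0" using P by (auto simp: coef_zero pairsD)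
  then show ?thesis using d(1) by blast
qed

text \<open>The spinor component splits off because \<open>(ad e\<^sub>P)\<^sup>2\<close> acts on it by a scalar that is not an
  eigenvalue on bivectors. A nonzero spinor in \<open>W\<close> yields a nonzero bivector there, hence all bivectors, and these
  carry \<open>S1\<close> into \<open>W\<close> as each \<open>e\<^sub>P\<close> acts invertibly.\<close>

lemma ideal_full:
  assumes W: "W \<subseteq> E" "0 \<in> W" "\<exists>w\<in>W. w \<noteq> 0"
    and add: "\<And>u v. u \<in> W \<Longrightarrow> v \<in> W \<Longrightarrow> u + v \<in> W"
    and scale: "\<And>a A \<phi>. (A, \<phi>) \<in> W \<Longrightarrow> (sC a A, sS a \<phi>) \<in> W"
    and ideal: "\<And>u w. u \<in> E \<Longrightarrow> w \<in> W \<Longrightarrow> bracket u w \<in> W"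
  shows "W = E"
proof -
  define J where "J = {A. (A, 0) \<in> W}"
  have JB: "J \<subseteq> bivectors" using W(1) by (auto simp: J_def)
  have sub: "subspace J"
  proof (rule subspaceI)
    show "0 \<in> J" using W(2) by (simp add: J_def zero_prod_def)
    show "x + z \<in> J" if "x \<in> J" "z \<in> J" for x z
      using add[of "(x, 0)" "(z, 0)"] that by (simp add: J_def)
    show "sC a x \<in> J" if "x \<in> J" for a x
      using scale[of x 0 a] that by (simp add: J_def)
  qed
  have J_ideal: "commutator Z X \<in> J" if "X \<in> J" "Z \<in> bivectors" for X Z
    using ideal[of "(Z, 0)" "(X, 0)"] that zero_in
    by (simp add: J_def bracket_pair spinor_bivector_zero rho_zero_right)
  have pair_ad: "(commutator (monomial P) A, \<rho> (monomial P) \<phi>) \<in> W" if "(A, \<phi>) \<in> W" "P \<in> pairs" for A \<phi> P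
    using ideal[of "(monomial P, 0)" "(A, \<phi>)"] that zero_in monomial_in_bivectors
    by (simp add: bracket_pair spinor_bivector_zero rho_zero_right)
  \<comment> \<open>applying \<open>(ad e\<^sub>P)\<^sup>4 - 4 e\<^sub>P\<^sup>2 (ad e\<^sub>P)\<^sup>2\<close> kills the bivector component and multiplies the spinor component by \<open>-3\<close>\<close>
  have split: "(0, \<phi>) \<in> W" if w: "(A, \<phi>) \<in> W" for A \<phi>
  proof -
    obtain P where P: "P \<in> pairs" using pairs_nonempty by blast
    have m: "mono_sq P * mono_sq P = 1" using mono_sq_square pairsD(1)[OF P] by blast
    have two: "(ad2 P X, sS (mono_sq P) \<chi>) \<in> W" if "(X, \<chi>) \<in> W" for X \<chi>
      using pair_ad[OF pair_ad[OF that P] P] by (simp add: ad2_def rho_pair_square[OF P])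
    have w2: "(ad2 P A, sS (mono_sq P) \<phi>) \<in> W" by (rule two[OF w])
    have w4: "(sC (4 * mono_sq P) (ad2 P A), \<phi>) \<in> W"
      using two[OF w2] by (simp add: ad2_ad2[OF P] m)
    have "(sC (- 4 * mono_sq P) (ad2 P A), sS (- 4) \<phi>) \<in> W"
      using scale[OF w2, of "- 4 * mono_sq P"] by (simp add: m mult.assoc)
    from add[OF w4 this] have "(0, \<phi> + sS (- 4) \<phi>) \<in> W" by simp
    moreover have "\<phi> + sS (- 4) \<phi> = sS (1 + - 4) \<phi>" by (simp only: S.scale_left_distrib S.scale_one)
    moreover have "(1 + - 4 :: 'k) = - 3" by simp
    ultimately have "(0, sS (- 3) \<phi>) \<in> W" by simp
    from scale[OF this, of "- 1 / 3"] show ?thesis using three_nonzero by simp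
  qed
  have "\<exists>A\<in>J. A \<noteq> 0"
  proof -
    obtain A \<phi> where w: "(A, \<phi>) \<in> W" "(A, \<phi>) \<noteq> 0" using W(3) by (metis surj_pair)
    show ?thesis
    proof (cases "\<phi> = 0")
      case True
      then show ?thesis using w by (auto simp: J_def zero_prod_def)
    next
      case False
      have "\<phi> \<in> S1" using w W(1) by auto
      then obtain \<psi> where \<psi>: "\<psi> \<in> S1" "spinor_bivector \<psi> \<phi> \<noteq> 0" using spinor_bivector_nonzero False by blast
      have "bracket (0, \<psi>) (0, \<phi>) \<in> W" using ideal split[OF w(1)] \<psi>(1) zero_in by blast
      then have "spinor_bivector \<psi> \<phi> \<in> J" by (simp add: bracket_pair J_def rho_zero)
      then show ?thesis using \<psi>(2) by blast
    qed
  qed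
  then have "J = bivectors" using bivector_ideal_full[OF _ JB _ _ sub J_ideal] card_I by auto
  then have C: "(A, 0) \<in> W" if "A \<in> bivectors" for A using that by (auto simp: J_def)
  have S: "(0, \<phi>) \<in> W" if \<phi>: "\<phi> \<in> S1" for \<phi>
  proof -
    obtain P where P: "P \<in> pairs" using pairs_nonempty by blast
    have m: "mono_sq P * mono_sq P = 1" using mono_sq_square pairsD(1)[OF P] by blast
    have "\<rho> (monomial P) \<phi> \<in> S1" using bivector_S1 monomial_in_bivectors[OF P] \<phi> by blast
    then have "bracket (0, \<rho> (monomial P) \<phi>) (monomial P, 0) \<in> W"
      using ideal C monomial_in_bivectors[OF P] zero_in by blast
    then have "(0, - sS (mono_sq P) \<phi>) \<in> W"
      by (simp add: bracket_pair spinor_bivector_zero rho_zero rho_pair_square[OF P])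
    from scale[OF this, of "- mono_sq P"] show ?thesis using m by simp
  qed
  have "E \<subseteq> W"
  proof
    fix u assume "u \<in> E"
    then obtain A \<phi> where "u = (A, 0) + (0, \<phi>)" "A \<in> bivectors" "\<phi> \<in> S1" by auto
    then show "u \<in> W" using add[OF C S] by simp
  qed
  then show ?thesis using W(1) by blast
qed

end

section \<open>Characterization and simplicity of the bracket\<close>

context e8_bracket
begin

lemma prod_scale: "module_prod.scale sC sS a (A, \<phi>) = (sC a A, sS a \<phi>)"
  and prod_vector_space: "vector_space (module_prod.scale sC sS)"
  and subspace_E: "module.subspace (module_prod.scale sC sS) E"
proof -
  interpret p: vector_space_prod sC sS by unfold_locales
  show "module_prod.scale sC sS a (A, \<phi>) = (sC a A, sS a \<phi>)" by (rule p.scale_prod)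
  show "vector_space (module_prod.scale sC sS)" by unfold_locales
  show "module.subspace (module_prod.scale sC sS) E"
    by (rule p.subspace_Times[OF subspace_bivectors subspace_S1])
qed

lemma prod_scale': "module_prod.scale sC sS a u = (sC a (fst u), sS a (snd u))"
  by (cases u) (simp add: prod_scale)

lemma bracket_add: "bracket (u + v) w = bracket u w + bracket v w" "bracket w (u + v) = bracket w u + bracket w v"
  by (simp_all add: bracket_def algebra_simps rho_add rho_add_right spinor_bivector_add)

lemma bracket_scale:
  "bracket (module_prod.scale sC sS a u) v = module_prod.scale sC sS a (bracket u v)"
  "bracket u (module_prod.scale sC sS a v) = module_prod.scale sC sS a (bracket u v)"
  by (simp_all add: bracket_def prod_scale' rho_scale rho_scale_right spinor_bivector_scale scale_mult
      scale_right_distrib scale_right_diff_distrib S.scale_right_diff_distrib)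

lemma bilinear_bracket:
  assumes "\<And>u v. u \<in> E \<Longrightarrow> v \<in> E \<Longrightarrow> br (u, v) = bracket u v"
  shows "bilinear_on (module_prod.scale sC sS) E br"
proof -
  interpret p: vector_space "module_prod.scale sC sS" by (rule prod_vector_space)
  have add: "u + v \<in> E" if "u \<in> E" "v \<in> E" for u v
    using p.subspace_add[OF subspace_E] that by blast
  have scale: "module_prod.scale sC sS a u \<in> E" if "u \<in> E" for a u
    using p.subspace_scale[OF subspace_E] that by blast
  show ?thesis
    unfolding bilinear_on_def
  proof (intro conjI ballI allI)
    fix u v w assume "u \<in> E" "v \<in> E" "w \<in> E"
    then show "br (u + v, w) = br (u, w) + br (v, w)" "br (u, v + w) = br (u, v) + br (u, w)"
      by (simp_all only: assms add bracket_add)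
  next
    fix a u v assume "u \<in> E" "v \<in> E"
    then show "br (module_prod.scale sC sS a u, v) = module_prod.scale sC sS a (br (u, v))"
      "br (u, module_prod.scale sC sS a v) = module_prod.scale sC sS a (br (u, v))"
      by (simp_all only: assms scale bracket_scale)
  qed
qed

text \<open>Bilinearity and antisymmetry reduce a bracket to its values on the three kinds of homogeneous pairs; extensionality fixes the rest.\<close>

lemma bivector_spinor_bracket_iff:
  "bivector_spinor_bracket (module_prod.scale sC sS) \<rho> spinor_bivector bivectors S1 br \<longleftrightarrow>
    br = restrict (\<lambda>(u, v). bracket u v) (E \<times> E)"
proof
  assume br: "bivector_spinor_bracket (module_prod.scale sC sS) \<rho> spinor_bivector bivectors S1 br"
  have ext: "br \<in> E \<times> E \<rightarrow>\<^sub>E E" and bil: "bilinear_on (module_prod.scale sC sS) E br"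
    and anti: "\<And>u v. u \<in> E \<Longrightarrow> v \<in> E \<Longrightarrow> br (u, v) = - br (v, u)"
    and cc: "\<And>A A'. A \<in> bivectors \<Longrightarrow> A' \<in> bivectors \<Longrightarrow> br ((A, 0), (A', 0)) = (commutator A A', 0)"
    and cs: "\<And>A \<psi>. A \<in> bivectors \<Longrightarrow> \<psi> \<in> S1 \<Longrightarrow> br ((A, 0), (0, \<psi>)) = (0, \<rho> A \<psi>)"
    and ss: "\<And>\<phi> \<psi>. \<phi> \<in> S1 \<Longrightarrow> \<psi> \<in> S1 \<Longrightarrow> br ((0, \<phi>), (0, \<psi>)) = (spinor_bivector \<phi> \<psi>, 0)"
    using br unfolding bivector_spinor_bracket_def by blast+
  have br_eq: "br (u, v) = bracket u v" if uv: "u \<in> E" "v \<in> E" for u v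
  proof -
    obtain A \<phi> A' \<phi>' where d: "u = (A, \<phi>)" "v = (A', \<phi>')" by (metis surj_pair)
    have mem: "A \<in> bivectors" "A' \<in> bivectors" "\<phi> \<in> S1" "\<phi>' \<in> S1" using uv d by auto
    then have E: "(A, 0) \<in> E" "(0, \<phi>) \<in> E" "(A', 0) \<in> E" "(0, \<phi>') \<in> E" using zero_in by auto
    have left: "br (a + b, w) = br (a, w) + br (b, w)" if "a \<in> E" "b \<in> E" "w \<in> E" for a b w
      using bil that unfolding bilinear_on_def by blast
    have right: "br (w, a + b) = br (w, a) + br (w, b)" if "a \<in> E" "b \<in> E" "w \<in> E" for a b w
      using bil that unfolding bilinear_on_def by blast
    have u: "u = (A, 0) + (0, \<phi>)" and v: "v = (A', 0) + (0, \<phi>')" using d by simp_all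
    have "br (u, v) = br ((A, 0), v) + br ((0, \<phi>), v)"
      unfolding u by (rule left[OF E(1,2) uv(2)])
    also have "br ((A, 0), v) = br ((A, 0), (A', 0)) + br ((A, 0), (0, \<phi>'))"
      unfolding v by (rule right[OF E(3,4,1)])
    also have "br ((0, \<phi>), v) = br ((0, \<phi>), (A', 0)) + br ((0, \<phi>), (0, \<phi>'))"
      unfolding v by (rule right[OF E(3,4,2)])
    also have "br ((0, \<phi>), (A', 0)) = - br ((A', 0), (0, \<phi>))" by (rule anti[OF E(2,3)])
    finally show ?thesis using mem by (simp add: cc cs ss d bracket_pair)
  qed
  show "br = restrict (\<lambda>(u, v). bracket u v) (E \<times> E)"
  proof
    fix w
    show "br w = restrict (\<lambda>(u, v). bracket u v) (E \<times> E) w"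
      using PiE_arb[OF ext] br_eq by (cases "w \<in> E \<times> E") (auto simp: restrict_def)
  qed
next
  assume br: "br = restrict (\<lambda>(u, v). bracket u v) (E \<times> E)"
  then have br_eq: "br (u, v) = bracket u v" if "u \<in> E" "v \<in> E" for u v using that by simp
  have "br \<in> E \<times> E \<rightarrow>\<^sub>E E" unfolding br
  proof (rule PiE_I)
    fix w assume "w \<in> E \<times> E"
    then obtain u v where "w = (u, v)" "u \<in> E" "v \<in> E" by blast
    then show "restrict (\<lambda>(u, v). bracket u v) (E \<times> E) w \<in> E" using bracket_in by simp
  qed simp
  moreover have "\<forall>u\<in>E. \<forall>v\<in>E. br (u, v) = - br (v, u)"
  proof (intro ballI)
    fix u v assume "u \<in> E" "v \<in> E"
    then show "br (u, v) = - br (v, u)" using bracket_antisym[of u v] by (simp only: br_eq)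
  qed
  moreover have "br ((A, 0), (A', 0)) = (commutator A A', 0)" if "A \<in> bivectors" "A' \<in> bivectors" for A A'
    using that zero_in br_eq[of "(A, 0)" "(A', 0)"]
    by (simp add: bracket_pair spinor_bivector_zero rho_zero_right)
  moreover have "br ((A, 0), (0, \<psi>)) = (0, \<rho> A \<psi>)" if "A \<in> bivectors" "\<psi> \<in> S1" for A \<psi>
    using that zero_in br_eq[of "(A, 0)" "(0, \<psi>)"]
    by (simp add: bracket_pair spinor_bivector_zero rho_zero_right)
  moreover have "br ((0, \<phi>), (0, \<psi>)) = (spinor_bivector \<phi> \<psi>, 0)" if "\<phi> \<in> S1" "\<psi> \<in> S1" for \<phi> \<psi>
    using that zero_in br_eq[of "(0, \<phi>)" "(0, \<psi>)"] by (simp add: bracket_pair rho_zero)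
  ultimately show "bivector_spinor_bracket (module_prod.scale sC sS) \<rho> spinor_bivector bivectors S1 br"
    unfolding bivector_spinor_bracket_def using bilinear_bracket[of br, OF br_eq] by blast
qed

lemma simple_bracket:
  assumes br: "\<And>u v. u \<in> E \<Longrightarrow> v \<in> E \<Longrightarrow> br (u, v) = bracket u v"
  shows "simple_lie_algebra (module_prod.scale sC sS) E br"
proof -
  interpret p: vector_space "module_prod.scale sC sS" by (rule prod_vector_space)
  have "lie_algebra (module_prod.scale sC sS) E br"
    unfolding lie_algebra_def
    using prod_vector_space subspace_E bilinear_bracket[of br, OF br] bracket_in
    by (auto simp del: mem_Times_iff simp: br bracket_self bracket_jacobi)
  moreover have "\<exists>u\<in>E. \<exists>v\<in>E. br (u, v) \<noteq> 0"
  proof -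
    obtain P where P: "P \<in> pairs" using pairs_nonempty by blast
    obtain a b where ab: "P = {a, b}" "a \<noteq> b" using pairsD(2)[OF P] by (auto simp: card_2_iff)
    have "P \<noteq> I" using pairsD(2)[OF P] card_I by auto
    then obtain c where c: "c \<in> I" "c \<notin> P" using pairsD(1)[OF P] by blast
    have Q: "{a, c} \<in> pairs" using ab c pairsD(1)[OF P] by (auto simp: pairs_def card_2_iff)
    have "P \<inter> {a, c} = {a}" using ab c by auto
    then have "coef (ad2 P (monomial {a, c})) {a, c} = 4 * mono_sq P"
      using coef_ad2[OF P pairsD(1)[OF Q]] coef_monomial[OF pairsD(1)[OF Q] pairsD(1)[OF Q]] by simp
    moreover have "(4::'k) = 2 * 2" by simp
    then have "(4::'k) \<noteq> 0" using two_nonzero by (metis mult_eq_0_iff)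
    moreover have "mono_sq P \<noteq> 0" using mono_sq_square[OF pairsD(1)[OF P]] by auto
    ultimately have "ad2 P (monomial {a, c}) \<noteq> 0" using pairsD(1)[OF Q] by (auto simp: coef_zero)
    then have "commutator (monomial P) (monomial {a, c}) \<noteq> 0" by (auto simp: ad2_def)
    then have "br ((monomial P, 0), (monomial {a, c}, 0)) \<noteq> 0"
      using P Q by (simp add: br monomial_in_bivectors zero_in bracket_pair spinor_bivector_zero zero_prod_def)
    then show ?thesis using P Q monomial_in_bivectors zero_in by blast
  qed
  moreover have "J = {0} \<or> J = E" if "lie_ideal (module_prod.scale sC sS) E br J" for J
  proof (cases "J = {0}")
    case False
    have J: "p.subspace J" "J \<subseteq> E" "\<And>u v. u \<in> E \<Longrightarrow> v \<in> J \<Longrightarrow> br (u, v) \<in> J"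
      using that unfolding lie_ideal_def by auto
    have "J = E"
    proof (rule ideal_full[OF J(2)])
      show "0 \<in> J" by (rule p.subspace_0[OF J(1)])
      then show "\<exists>w\<in>J. w \<noteq> 0" using False by auto
      show "u + v \<in> J" if "u \<in> J" "v \<in> J" for u v using p.subspace_add[OF J(1)] that by blast
      show "(sC a A, sS a \<phi>) \<in> J" if "(A, \<phi>) \<in> J" for a A \<phi>
        using p.subspace_scale[OF J(1) that, of a] by (simp add: prod_scale)
      show "bracket u w \<in> J" if "u \<in> E" "w \<in> J" for u w
        using J(3)[OF that] br[of u w] that J(2) by auto
    qed
    then show ?thesis ..
  qed simp
  ultimately show ?thesis unfolding simple_lie_algebra_def by blast
qed

lemma dim_E: "vector_space.dim (module_prod.scale sC sS) E = 120 + S.dim S1"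
proof -
  have "span (monomial ` Pow I) = UNIV"
  proof -
    have "c \<in> span (monomial ` Pow I)" for c
      by (subst monomial_expansion[of c]) (intro span_sum span_scale span_base, simp)
    then show ?thesis by blast
  qed
  moreover obtain X where X: "X \<subseteq> monomial ` Pow I" "independent X" "monomial ` Pow I \<subseteq> span X"
    by (rule maximal_independent_subset)
  ultimately have spanX: "span X = UNIV" using span_mono[OF X(3)] by (auto simp: span_span)
  have finX: "finite X" using X(1) by (rule finite_subset) simp
  obtain Y where Y: "S.independent Y" "UNIV \<subseteq> S.span Y" "card Y = S.dim UNIV"
    by (rule S.basis_exists[of UNIV]) auto
  have "card Y \<noteq> 0" using Y dim_S by simp
  then have finY: "finite Y" by (auto intro: card_ge_0_finite)
  interpret fp: finite_dimensional_vector_space_prod sC sS X Y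
    using X(2) spanX finX Y finY by unfold_locales auto
  have choose: "16 choose 2 = (120::nat)" by (simp add: numeral_eq_Suc)
  show ?thesis
    using fp.dim_Times[OF subspace_bivectors subspace_S1] by (simp add: dim_bivectors card_I choose)
qed

end

section \<open>Clifford algebras given by generators and relations\<close>

lemma word_eval_superset:
  assumes "vector_space sC" "finite F" "Poly_Mapping.keys p \<subseteq> F"
  shows "word_eval sC \<iota> p = (\<Sum>vs\<in>F. sC (Poly_Mapping.lookup p vs) (prod_list (map \<iota> vs)))"
proof -
  interpret vector_space sC by fact
  show ?thesis unfolding word_eval_def
    using assms(2,3) by (intro sum.mono_neutral_left) (auto simp: in_keys_iff)
qed

lemma word_eval_add:
  assumes "vector_space sC"
  shows "word_eval sC \<iota> (p + q) = word_eval sC \<iota> p + word_eval sC \<iota> q"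
proof -
  interpret vector_space sC by fact
  let ?F = "Poly_Mapping.keys p \<union> Poly_Mapping.keys q"
  note sup = word_eval_superset[OF assms, of ?F]
  show ?thesis
    by (simp add: sup keys_add lookup_add scale_left_distrib sum.distrib)
qed

lemma word_eval_diff:
  assumes "vector_space sC"
  shows "word_eval sC \<iota> (p - q) = word_eval sC \<iota> p - word_eval sC \<iota> q"
  using word_eval_add[OF assms, of \<iota> "p - q" q] by simp

lemma word_eval_single:
  assumes "vector_space sC"
  shows "word_eval sC \<iota> (Poly_Mapping.single vs a) = sC a (prod_list (map \<iota> vs))"
  using word_eval_superset[OF assms, of "{vs}" "Poly_Mapping.single vs a"] by simp

context
  fixes sV :: "'k::field \<Rightarrow> 'v::ab_group_add \<Rightarrow> 'v" and g sC and \<iota> :: "'v \<Rightarrow> 'c::ring_1"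
  assumes cl: "is_clifford_algebra sV g sC \<iota>"
begin

lemma clifford_vector_space: "vector_space sC"
  using cl by (simp add: is_clifford_algebra_def unital_algebra_def)

lemma clifford_ideal_eval: "p \<in> clifford_ideal sV g \<Longrightarrow> word_eval sC \<iota> p = 0"
  using cl unfolding is_clifford_algebra_def by blast

lemmas eval_simps = word_eval_add[OF clifford_vector_space] word_eval_diff[OF clifford_vector_space]
  word_eval_single[OF clifford_vector_space]

lemma clifford_generator_add: "\<iota> (v + w) = \<iota> v + \<iota> w"
proof -
  interpret vector_space sC by (rule clifford_vector_space)
  show ?thesis
    using clifford_ideal_eval[OF clifford_ideal.rel_add[of "[]" v w "[]"]]
    by (simp add: eval_simps algebra_simps)
qed

lemma clifford_generator_scale: "\<iota> (sV a v) = sC a (\<iota> v)"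
proof -
  interpret vector_space sC by (rule clifford_vector_space)
  show ?thesis
    using clifford_ideal_eval[OF clifford_ideal.rel_scale[of "[]" sV a v "[]"]]
    by (simp add: eval_simps)
qed

lemma clifford_relation: "\<iota> v * \<iota> w + \<iota> w * \<iota> v = sC (2 * g v w) 1"
proof -
  interpret vector_space sC by (rule clifford_vector_space)
  show ?thesis
    using clifford_ideal_eval[OF clifford_ideal.rel_clifford[of "[]" v w "[]"]]
    by (simp add: eval_simps)
qed

text \<open>Left multiplications by vectors that preserve \<open>W\<close> form a subspace, so it suffices to check a spanning set; words then follow by induction.\<close>

lemma clifford_generated:
  assumes sub: "module.subspace sC W" and one: "1 \<in> W"
    and gen: "\<And>b w. b \<in> X \<Longrightarrow> w \<in> W \<Longrightarrow> \<iota> b * w \<in> W"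
    and V: "vector_space sV" "module.span sV X = UNIV"
  shows "W = UNIV"
proof -
  interpret vector_space sC by (rule clifford_vector_space)
  interpret V: vector_space sV by (rule V(1))
  have zero: "\<iota> 0 = 0" using clifford_generator_scale[of 0 0] by simp
  have scale_mult: "sC a c * d = sC a (c * d)" for a c d
    using cl by (simp add: is_clifford_algebra_def unital_algebra_def)
  have any: "\<forall>w\<in>W. \<iota> v * w \<in> W" for v
  proof -
    have "v \<in> V.span X" using V(2) by simp
    then show ?thesis
    proof (induction rule: V.span_induct_alt)
      case base
      then show ?case using subspace_0[OF sub] by (simp add: zero)
    next
      case (step a b v)
      show ?case
      proof
        fix w assume "w \<in> W"
        then have "\<iota> b * w \<in> W" "\<iota> v * w \<in> W" using step gen by auto
        then have "sC a (\<iota> b * w) + \<iota> v * w \<in> W"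
          by (intro subspace_add[OF sub] subspace_scale[OF sub])
        then show "\<iota> (sV a b + v) * w \<in> W"
          by (simp add: clifford_generator_add clifford_generator_scale distrib_right scale_mult)
      qed
    qed
  qed
  have word: "prod_list (map \<iota> vs) \<in> W" for vs
    by (induction vs) (use one any in auto)
  have "c \<in> W" for c
  proof -
    obtain p where "c = word_eval sC \<iota> p" using cl unfolding is_clifford_algebra_def by (metis UNIV_I imageE)
    then show ?thesis unfolding word_eval_def
      by (auto intro!: subspace_sum[OF sub] subspace_scale[OF sub] word)
  qed
  then show ?thesis by blast
qed

end

lemma (in clifford_frame) bivectors_eq_span_products:
  assumes "I = {1..m}"
  shows "bivectors = span {y i * y j | i j. 1 \<le> i \<and> i < j \<and> j \<le> m}"
proof -
  have "monomial ` pairs = {y i * y j | i j. 1 \<le> i \<and> i < j \<and> j \<le> m}"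
  proof (intro equalityI subsetI)
    fix c assume "c \<in> monomial ` pairs"
    then obtain P where P: "P \<in> pairs" "c = monomial P" by blast
    then obtain i j where "P = {i, j}" "i < j"
      using pairsD(2)[OF P(1)] by (metis card_2_iff insert_commute linorder_neqE_nat)
    then show "c \<in> {y i * y j | i j. 1 \<le> i \<and> i < j \<and> j \<le> m}"
      using P assms pairsD(1)[OF P(1)] by (auto simp: monomial_pair)
  next
    fix c assume "c \<in> {y i * y j | i j. 1 \<le> i \<and> i < j \<and> j \<le> m}"
    then obtain i j where ij: "c = y i * y j" "1 \<le> i" "i < j" "j \<le> m" by blast
    then have "{i, j} \<subseteq> I" unfolding assms by auto
    then have "{i, j} \<in> pairs" using ij by (simp add: pairs_def)
    then show "c \<in> monomial ` pairs" using ij by (metis image_eqI monomial_pair)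
  qed
  then show ?thesis by (simp add: bivectors_def)
qed

lemma (in clifford_frame) sum_pairs:
  assumes "I = {1..m}"
  shows "(\<Sum>P\<in>pairs. h P) = (\<Sum>j=1..m. \<Sum>i=1..<j. h {i, j})"
proof -
  have "bij_betw (\<lambda>(j, i). {i, j}) (SIGMA j:{1..m}. {1..<j}) pairs"
  proof (rule bij_betw_imageI)
    show "inj_on (\<lambda>(j, i). {i, j}) (SIGMA j:{1..m}. {1..<j})"
      by (auto simp: inj_on_def doubleton_eq_iff)
    show "(\<lambda>(j, i). {i, j}) ` (SIGMA j:{1..m}. {1..<j}) = pairs"
    proof (intro equalityI subsetI)
      fix P assume "P \<in> (\<lambda>(j, i). {i, j}) ` (SIGMA j:{1..m}. {1..<j})"
      then obtain i j where ij: "P = {i, j}" "j \<in> {1..m}" "i \<in> {1..<j}" by auto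
      then have "P \<subseteq> I" unfolding assms by auto
      then show "P \<in> pairs" using ij by (simp add: pairs_def)
    next
      fix P assume P: "P \<in> pairs"
      then obtain i j where ij: "P = {i, j}" "i < j"
        using pairsD(2)[OF P] by (metis card_2_iff insert_commute linorder_neqE_nat)
      then have "(j, i) \<in> (SIGMA j:{1..m}. {1..<j})" using assms pairsD(1)[OF P] by auto
      then show "P \<in> (\<lambda>(j, i). {i, j}) ` (SIGMA j:{1..m}. {1..<j})"
        using ij by (intro image_eqI[of _ _ "(j, i)"]) auto
    qed
  qed
  then have "(\<Sum>P\<in>pairs. h P) = (\<Sum>(j, i)\<in>(SIGMA j:{1..m}. {1..<j}). h {i, j})"
    by (simp add: sum.reindex_bij_betw[symmetric] case_prod_unfold)
  then show ?thesis by (simp add: sum.Sigma)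
qed

lemma (in spinor_form) spinor_bivector_eq_L2_tilde:
  assumes "I = {1..m}" "\<And>i. i \<in> I \<Longrightarrow> y i = \<iota> (x i)" "\<And>i. i \<in> I \<Longrightarrow> \<eta> i = g (x i) (x i)"
  shows "L2_tilde g sC \<iota> \<rho> B m x \<phi> \<psi> = spinor_bivector \<phi> \<psi>"
proof -
  have "sC (g (x i) (x i) * g (x j) (x j) * B \<phi> (\<rho> (\<iota> (x j) * \<iota> (x i)) \<psi>)) (\<iota> (x i) * \<iota> (x j)) =
      sC (mono_sq {i, j} * B \<phi> (\<rho> (monomial {i, j}) \<psi>)) (monomial {i, j})"
    if "j \<in> {1..m}" "i \<in> {1..<j}" for i j
  proof -
    have ij: "i \<in> I" "j \<in> I" "i < j" using that assms(1) by auto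
    have anti: "y j * y i = - (y i * y j)" using gen_anticommute[of j i] ij by simp
    have "mono_sq {i, j} = - (\<eta> i * \<eta> j)" using ij by (simp add: mono_sq_def swap_sign_mod4)
    then show ?thesis using ij
      by (simp add: monomial_pair assms(2,3)[symmetric] anti rho_minus form_minus)
  qed
  then show ?thesis
    unfolding L2_tilde_def spinor_bivector_def sum_pairs[OF assms(1)]
    by (intro arg_cong[of _ _ "sC (1 / 2)"] sum.cong) auto
qed

theorem proposition8p1:
  fixes sV :: "'k::field \<Rightarrow> 'v::ab_group_add \<Rightarrow> 'v"
    and g :: "'v \<Rightarrow> 'v \<Rightarrow> 'k"
    and sC :: "'k \<Rightarrow> 'c::ring_1 \<Rightarrow> 'c"
    and \<iota> :: "'v \<Rightarrow> 'c"
    and sS :: "'k \<Rightarrow> 's::ab_group_add \<Rightarrow> 's"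
    and \<rho> :: "'c \<Rightarrow> 's \<Rightarrow> 's"
    and S1 S2 :: "'s set"
    and B :: "'s \<Rightarrow> 's \<Rightarrow> 'k"
    and x :: "nat \<Rightarrow> 'v"
    and n :: nat
  defines "C2 \<equiv> clifford_two sC \<iota> (2 * n) x"
    and "sE \<equiv> module_prod.scale sC sS"
    and "L \<equiv> L2_tilde g sC \<iota> \<rho> B (2 * n) x"
  assumes "CHAR('k) \<noteq> 2" and "CHAR('k) \<noteq> 3"
    and "n = 8"
    and "vector_space sV" and "vector_space.dim sV UNIV = 2 * n"
    and "bilinear_form sV g" and "\<forall>v w. g v w = g w v" and "nondegenerate g"
    and "witt_index sV g = n"
    and "is_clifford_algebra sV g sC \<iota>"
    and "vector_space sS" and "vector_space.dim sS UNIV = 2 ^ n"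
    and "algebra_iso_End sC sS \<rho>"
    and "half_spinor_decomposition sC \<iota> sS \<rho> n S1 S2"
    and "spinor_norm \<iota> sS \<rho> B" and "nondegenerate B"
    and "orthonormal_basis sV g (2 * n) x"
  shows "vector_space.dim sE (C2 \<times> S1) = 248 \<and>
    (\<exists>!br. bivector_spinor_bracket sE \<rho> L C2 S1 br) \<and>
    (\<forall>br. bivector_spinor_bracket sE \<rho> L C2 S1 br \<longrightarrow> simple_lie_algebra sE (C2 \<times> S1) br)"
proof -
  note cl = \<open>is_clifford_algebra sV g sC \<iota>\<close> and iso = \<open>algebra_iso_End sC sS \<rho>\<close>
    and half = \<open>half_spinor_decomposition sC \<iota> sS \<rho> n S1 S2\<close>
    and orth = \<open>orthonormal_basis sV g (2 * n) x\<close>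
  define y where "y = (\<lambda>i. \<iota> (x i))"
  define \<eta> where "\<eta> = (\<lambda>i. g (x i) (x i))"
  define I where "I = {1..16::nat}"
  interpret C: vector_space sC by (rule clifford_vector_space[OF cl])
  interpret V: vector_space sV by fact
  interpret S: vector_space sS by fact
  have prime_char: "of_nat p \<noteq> (0::'k)" if "prime p" "CHAR('k) \<noteq> p" for p
  proof
    assume "of_nat p = (0::'k)"
    then have "CHAR('k) dvd p" by (simp add: of_nat_eq_0_iff_char_dvd)
    then show False using that CHAR_not_1[where 'a = 'k] by (auto simp: prime_nat_iff)
  qed
  have two: "(2::'k) \<noteq> 0" using prime_char[of 2] \<open>CHAR('k) \<noteq> 2\<close> by simp
  have three: "(3::'k) \<noteq> 0" using prime_char[of 3] \<open>CHAR('k) \<noteq> 3\<close> by simp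
  have dimS: "S.dim UNIV = 256" using assms by simp
  have "(of_nat (S.dim UNIV) :: 'k) = 2 ^ 8" by (simp add: dimS)
  then have dim_nz: "(of_nat (S.dim UNIV) :: 'k) \<noteq> 0" using power_not_zero[OF two] by metis
  have one: "(1::'c) \<noteq> 0"
  proof
    assume "(1::'c) = 0"
    then have "\<rho> 1 = \<rho> (sC 0 0)" by simp
    then have "\<psi> = 0" for \<psi> :: 's
      using iso unfolding algebra_iso_End_def by (metis S.scale_zero_left id_apply)
    then have "(UNIV :: 's set) = {0}" by auto
    then have "S.dim (UNIV :: 's set) = S.dim {0 :: 's}" by simp
    also have "\<dots> = S.dim ({} :: 's set)" by (metis S.dim_span S.span_empty)
    also have "\<dots> = 0" using S.dim_eq_card_independent[OF S.independent_empty] by simp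
    finally show False using dimS by simp
  qed
  have unital: "sC a c * d = sC a (c * d)" "c * sC a d = sC a (c * d)" for a c d
    using cl unfolding is_clifford_algebra_def unital_algebra_def by metis+
  have spanX: "V.span (x ` I) = UNIV"
    and norm: "\<And>i. i \<in> I \<Longrightarrow> g (x i) (x i) = 1 \<or> g (x i) (x i) = - 1"
    and orthogonal: "\<And>i j. i \<in> I \<Longrightarrow> j \<in> I \<Longrightarrow> i \<noteq> j \<Longrightarrow> g (x i) (x j) = 0"
    using orth \<open>n = 8\<close> by (auto simp: orthonormal_basis_def I_def)
  have square: "y i * y i = sC (\<eta> i) 1" for i
  proof -
    have "sC 2 (y i * y i) = sC 2 (sC (\<eta> i) 1)"
      using clifford_relation[OF cl, of "x i" "x i"]
      by (simp add: y_def \<eta>_def) (metis C.scale_left_distrib C.scale_one one_add_one)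
    then show ?thesis using two by (simp add: C.scale_left_imp_eq)
  qed
  have anticommute: "y i * y j = - (y j * y i)" if "i \<in> I" "j \<in> I" "i \<noteq> j" for i j
    using clifford_relation[OF cl, of "x i" "x j"] orthogonal[OF that]
    by (simp add: y_def eq_neg_iff_add_eq_0)
  have odd_gen: "y i \<in> clifford_odd sC \<iota>" for i
    unfolding clifford_odd_def y_def
    by (intro C.span_base CollectI exI[of _ "[x i]"]) simp
  have half1: "S.subspace S1" "S.subspace S2" "S1 \<inter> S2 = {0}" "S.dim S1 = 128"
    and half2: "{\<phi> + \<psi> | \<phi> \<psi>. \<phi> \<in> S1 \<and> \<psi> \<in> S2} = UNIV"
    and half3: "\<And>c. c \<in> clifford_odd sC \<iota> \<Longrightarrow> \<rho> c ` S1 \<subseteq> S2 \<and> \<rho> c ` S2 \<subseteq> S1"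
    using half \<open>n = 8\<close> by (simp_all add: half_spinor_decomposition_def)
  have index: "finite I" "even (card I)" "card I = 16" by (simp_all add: I_def)
  interpret e8_bracket sC y \<eta> I sS \<rho> B S1 S2
  proof unfold_locales
    show "W = UNIV" if "C.subspace W" "1 \<in> W" "\<And>i w. i \<in> I \<Longrightarrow> w \<in> W \<Longrightarrow> y i * w \<in> W" for W
      using clifford_generated[OF cl that(1,2) _ V.vector_space_axioms spanX] that(3)
      by (auto simp: y_def)
    show "\<eta> i * \<eta> i = 1" if "i \<in> I" for i using norm[OF that] by (auto simp: \<eta>_def)
    show "bilinear_form sS B" using \<open>spinor_norm \<iota> sS \<rho> B\<close> by (simp add: spinor_norm_def)
    show "B (\<rho> (y i) \<phi>) \<psi> = B \<phi> (\<rho> (y i) \<psi>)" for i \<phi> \<psi>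
      using \<open>spinor_norm \<iota> sS \<rho> B\<close> by (simp add: spinor_norm_def y_def)
    show "\<exists>\<phi>\<in>S1. \<exists>\<psi>\<in>S2. \<chi> = \<phi> + \<psi>" for \<chi> using half2 by blast
    show "\<rho> (y i) \<phi> \<in> S2" if "\<phi> \<in> S1" for i \<phi> using half3[OF odd_gen] that by blast
    show "\<rho> (y i) \<phi> \<in> S1" if "\<phi> \<in> S2" for i \<phi> using half3[OF odd_gen] that by blast
    show "\<phi> = 0" if "\<And>\<psi>. B \<psi> \<phi> = 0" for \<phi>
      using \<open>nondegenerate B\<close> that by (simp add: nondegenerate_def)
  qed (assumption | rule unital two three one iso dimS dim_nz half1 index square anticommute)+
  have I: "I = {1..2 * n}" by (simp add: I_def \<open>n = 8\<close>)
  have C2: "C2 = bivectors"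
    unfolding bivectors_eq_span_products[OF I] by (simp only: C2_def clifford_two_def y_def)
  have L: "L = spinor_bivector"
    unfolding L_def by (intro ext spinor_bivector_eq_L2_tilde[OF I]) (simp_all add: y_def \<eta>_def)
  have "vector_space.dim sE (C2 \<times> S1) = 248"
    unfolding sE_def C2 dim_E by (simp add: half1(4))
  moreover have unique: "bivector_spinor_bracket sE \<rho> L C2 S1 br \<longleftrightarrow>
      br = restrict (\<lambda>(u, v). bracket u v) (E \<times> E)" for br
    unfolding sE_def C2 L by (rule bivector_spinor_bracket_iff)
  moreover have "simple_lie_algebra sE (C2 \<times> S1) (restrict (\<lambda>(u, v). bracket u v) (E \<times> E))"
    unfolding sE_def C2 by (rule simple_bracket) simp
  ultimately show ?thesis by simp
qed

end
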